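(* Let $p$ be a prime and let $$f(X)=\xi_0+\xi_1X+\dots+\xi_{n-1}X^{n-1}+X^n$$ where $\xi_0,\dots,\xi_{n-1}$ are i.i.d. random variables taking values in $\mathbb{Z}_p$ distributed according to the Haar measure on $\mathbb{Z}_p$. Then $$\mathbb{E}\left[C_{\mathbb{Q}_p}(f)\right]=\frac{p}{p+1}.$$
   Context: $\mathbb{Q}_p$ is the field of $p$-adic numbers and $\mathbb{Z}_p$ is the ring of $p$-adic integers. The Haar measure $\mu$ on $\mathbb{Q}_p$ is the translation-invariant regular Borel measure normalized by $\mu(\mathbb{Z}_p)=1$, and the law of each $\xi_i$ is $\mu$ restricted to $\mathbb{Z}_p$. $C_{\mathbb{Q}_p}(f)=\#\{x\in\mathbb{Q}_p:f(x)=0\}$ is the number of roots of $f$ in $\mathbb{Q}_p$ without multiplicities; since $f$ is monic with coefficients in $\mathbb{Z}_p$, this equals the number of roots of $f$ in $\mathbb{Z}_p$.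
   Formalization: The degree n is assumed to be at least 2; for n = 1 the polynomial ξ_0 + X always has exactly one root and for n = 0 it has none, so the stated expectation p/(p+1) fails in both cases. *)

theory Defs
  imports "HOL-Probability.Probability" "Berlekamp_Zassenhaus.Finite_Field"
begin

section \<open>The p-adic absolute value on the rational numbers\<close>

definition padic_abs :: "nat \<Rightarrow> rat \<Rightarrow> real" where
  "padic_abs p x = (if x = 0 then 0 else
     real p powi (int (multiplicity (int p) (snd (quotient_of x)))
                  - int (multiplicity (int p) (fst (quotient_of x)))))"

context
  fixes p :: nat
  assumes p: "prime p"
begin

lemma padic_abs_frac:
  assumes "a \<noteq> 0" "b \<noteq> 0"
  shows "padic_abs p (of_int a / of_int b) =
    real p powi (int (multiplicity (int p) b) - int (multiplicity (int p) a))"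
proof -
  let ?x = "of_int a / of_int b :: rat"
  obtain c d where cd: "quotient_of ?x = (c, d)" by fastforce
  have d: "d > 0" using quotient_of_denom_pos[OF cd] .
  have x: "?x = of_int c / of_int d" using quotient_of_div[OF cd] .
  have x0: "?x \<noteq> 0" using assms by simp
  have c: "c \<noteq> 0" using x x0 by auto
  have "of_int (a * d) = (of_int (c * b) :: rat)"
    using x assms d by (simp add: field_simps)
  hence "a * d = c * b" by (simp only: of_int_eq_iff)
  moreover have "prime_elem (int p)" using p by simp
  ultimately have "multiplicity (int p) a + multiplicity (int p) d
    = multiplicity (int p) c + multiplicity (int p) b"
    using assms c d by (metis less_irrefl prime_elem_multiplicity_mult_distrib)
  thus ?thesis using x0 by (simp add: padic_abs_def cd) (smt (verit) of_nat_add)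
qed

lemma padic_abs_zero [simp]: "padic_abs p 0 = 0"
  by (simp add: padic_abs_def)

lemma padic_abs_pos: "x \<noteq> 0 \<Longrightarrow> padic_abs p x > 0"
  using prime_gt_0_nat[OF p] by (simp add: padic_abs_def)

lemma padic_abs_nonneg [simp]: "padic_abs p x \<ge> 0"
  using padic_abs_pos[of x] by (cases "x = 0") auto

lemma padic_abs_eq_0_iff [simp]: "padic_abs p x = 0 \<longleftrightarrow> x = 0"
  using padic_abs_pos[of x] by (cases "x = 0") auto

lemma padic_abs_one [simp]: "padic_abs p 1 = 1"
  using padic_abs_frac[of 1 1] by simp

lemma padic_abs_mult: "padic_abs p (x * y) = padic_abs p x * padic_abs p y"
proof (cases "x = 0 \<or> y = 0")
  case False
  obtain a b where x: "x = of_int a / of_int b" "b > 0"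
    using quotient_of_div quotient_of_denom_pos by (metis surj_pair)
  obtain c d where y: "y = of_int c / of_int d" "d > 0"
    using quotient_of_div quotient_of_denom_pos by (metis surj_pair)
  have nz: "a \<noteq> 0" "b \<noteq> 0" "c \<noteq> 0" "d \<noteq> 0" using False x y by auto
  have pe: "prime_elem (int p)" using p by simp
  have "x * y = of_int (a * c) / of_int (b * d)" using x y by simp
  hence "padic_abs p (x * y) = real p powi
     (int (multiplicity (int p) (b * d)) - int (multiplicity (int p) (a * c)))"
    using padic_abs_frac[of "a * c" "b * d"] nz by simp
  also have "\<dots> = real p powi ((int (multiplicity (int p) b) - int (multiplicity (int p) a))
       + (int (multiplicity (int p) d) - int (multiplicity (int p) c)))"
    using nz pe by (simp add: prime_elem_multiplicity_mult_distrib algebra_simps)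
  also have "\<dots> = padic_abs p x * padic_abs p y"
    unfolding x y padic_abs_frac[OF nz(1,2)] padic_abs_frac[OF nz(3,4)]
    using prime_gt_0_nat[OF p] by (subst power_int_add) auto
  finally show ?thesis .
qed auto

lemma padic_abs_uminus [simp]: "padic_abs p (- x) = padic_abs p x"
proof -
  have "padic_abs p (- 1) * padic_abs p (- 1) = 1" by (simp flip: padic_abs_mult)
  hence "padic_abs p (- 1) = 1"
    using padic_abs_nonneg[of "- 1"] by (auto simp: square_eq_1_iff)
  thus ?thesis using padic_abs_mult[of "-1" x] by simp
qed

lemma padic_abs_ultra: "padic_abs p (x + y) \<le> max (padic_abs p x) (padic_abs p y)"
proof (cases "x = 0 \<or> y = 0 \<or> x + y = 0")
  case True
  thus ?thesis by (auto simp: max_def)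
next
  case False
  obtain a b where x: "x = of_int a / of_int b" "b > 0"
    using quotient_of_div quotient_of_denom_pos by (metis surj_pair)
  obtain c d where y: "y = of_int c / of_int d" "d > 0"
    using quotient_of_div quotient_of_denom_pos by (metis surj_pair)
  define e where "e = b * d"
  have e: "e \<noteq> 0" using x y by (simp add: e_def)
  have x': "x = of_int (a * d) / of_int e" and y': "y = of_int (c * b) / of_int e"
    using x y by (auto simp: e_def)
  have s: "x + y = of_int (a * d + c * b) / of_int e"
    unfolding x' y' by (simp add: add_divide_distrib)
  have "a * d + c * b \<noteq> 0"
  proof
    assume "a * d + c * b = 0"
    thus False using s False by (simp only: of_int_0 div_0) simp
  qed
  hence nz: "a * d \<noteq> 0" "c * b \<noteq> 0" "a * d + c * b \<noteq> 0"
    using False x' y' by auto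
  let ?m = "\<lambda>k. multiplicity (int p) k"
  have nu: "\<not> is_unit (int p)" using prime_gt_1_nat[OF p] by simp
  have "int p ^ min (?m (a * d)) (?m (c * b)) dvd a * d + c * b"
    by (intro dvd_add multiplicity_dvd') auto
  hence m: "min (?m (a * d)) (?m (c * b)) \<le> ?m (a * d + c * b)"
    using nz nu by (intro multiplicity_geI) auto
  have le: "real p powi i \<le> real p powi j" if "i \<le> j" for i j :: int
    using that prime_gt_1_nat[OF p] by (intro power_int_increasing) auto
  have "padic_abs p (x + y) = real p powi (int (?m e) - int (?m (a * d + c * b)))"
    unfolding s by (rule padic_abs_frac) (use nz e in auto)
  moreover have "padic_abs p x = real p powi (int (?m e) - int (?m (a * d)))"
    unfolding x' by (rule padic_abs_frac) (use nz e in auto)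
  moreover have "padic_abs p y = real p powi (int (?m e) - int (?m (c * b)))"
    unfolding y' by (rule padic_abs_frac) (use nz e in auto)
  ultimately show ?thesis
    using m le[of "int (?m e) - int (?m (a * d + c * b))" "int (?m e) - int (?m (a * d))"]
      le[of "int (?m e) - int (?m (a * d + c * b))" "int (?m e) - int (?m (c * b))"]
    by linarith
qed

lemma padic_abs_triangle: "padic_abs p (x + y) \<le> padic_abs p x + padic_abs p y"
  using padic_abs_ultra[of x y] padic_abs_nonneg[of x] padic_abs_nonneg[of y] by linarith

lemma padic_abs_minus_commute: "padic_abs p (x - y) = padic_abs p (y - x)"
  using padic_abs_uminus[of "x - y"] by simp

lemma padic_abs_diff_ineq: "\<bar>padic_abs p x - padic_abs p y\<bar> \<le> padic_abs p (x - y)"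
  using padic_abs_triangle[of "x - y" y] padic_abs_triangle[of "y - x" x]
    padic_abs_minus_commute[of x y] by simp

lemma padic_abs_inverse: "padic_abs p (inverse x) = inverse (padic_abs p x)"
proof (cases "x = 0")
  case False
  have "padic_abs p (inverse x) * padic_abs p x = 1"
    using False by (simp flip: padic_abs_mult)
  thus ?thesis using inverse_unique by (metis mult.commute)
qed simp

end


section \<open>Cauchy sequences with respect to the p-adic absolute value\<close>

definition padic_vanishes :: "nat \<Rightarrow> (nat \<Rightarrow> rat) \<Rightarrow> bool" where
  "padic_vanishes p X \<longleftrightarrow> (\<lambda>n. padic_abs p (X n)) \<longlonglongrightarrow> 0"

definition padic_cauchy :: "nat \<Rightarrow> (nat \<Rightarrow> rat) \<Rightarrow> bool" where
  "padic_cauchy p X \<longleftrightarrow> (\<forall>e>0. \<exists>N. \<forall>m\<ge>N. \<forall>n\<ge>N. padic_abs p (X m - X n) < e)"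

definition padic_rel :: "nat \<Rightarrow> (nat \<Rightarrow> rat) \<Rightarrow> (nat \<Rightarrow> rat) \<Rightarrow> bool" where
  "padic_rel p X Y \<longleftrightarrow>
     padic_cauchy p X \<and> padic_cauchy p Y \<and> padic_vanishes p (\<lambda>n. X n - Y n)"

context
  fixes p :: nat
  assumes p: "prime p"
begin

lemma padic_vanishes_le:
  assumes "padic_vanishes p X" "\<And>n. padic_abs p (Y n) \<le> C * padic_abs p (X n)"
  shows "padic_vanishes p Y"
proof -
  have "(\<lambda>n. C * padic_abs p (X n)) \<longlonglongrightarrow> C * 0"
    using assms(1) unfolding padic_vanishes_def by (intro tendsto_intros)
  hence lim: "(\<lambda>n. C * padic_abs p (X n)) \<longlonglongrightarrow> 0" by simp
  show ?thesis unfolding padic_vanishes_def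
    by (rule tendsto_sandwich[OF _ _ tendsto_const lim])
      (use assms(2) padic_abs_nonneg[OF p] in auto)
qed

lemma padic_vanishes_minus: "padic_vanishes p X \<Longrightarrow> padic_vanishes p (\<lambda>n. - X n)"
  by (simp add: padic_vanishes_def padic_abs_uminus[OF p])

lemma padic_vanishes_add:
  assumes "padic_vanishes p X" "padic_vanishes p Y"
  shows "padic_vanishes p (\<lambda>n. X n + Y n)"
proof -
  have lim: "(\<lambda>n. padic_abs p (X n) + padic_abs p (Y n)) \<longlonglongrightarrow> 0"
    using tendsto_add[OF assms[unfolded padic_vanishes_def]] by simp
  show ?thesis unfolding padic_vanishes_def
    by (rule tendsto_sandwich[OF _ _ tendsto_const lim])
      (use padic_abs_triangle[OF p] padic_abs_nonneg[OF p] in auto)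
qed

lemma padic_vanishes_const: "padic_vanishes p (\<lambda>n. c) \<longleftrightarrow> c = 0"
  by (auto simp: padic_vanishes_def LIMSEQ_const_iff padic_abs_eq_0_iff[OF p])

lemma padic_cauchy_const: "padic_cauchy p (\<lambda>n. c)"
  by (simp add: padic_cauchy_def padic_abs_zero[OF p])

lemma padic_cauchy_minus: "padic_cauchy p X \<Longrightarrow> padic_cauchy p (\<lambda>n. - X n)"
  unfolding padic_cauchy_def minus_diff_minus padic_abs_uminus[OF p] .

lemma padic_cauchy_add:
  assumes "padic_cauchy p X" "padic_cauchy p Y"
  shows "padic_cauchy p (\<lambda>n. X n + Y n)"
  unfolding padic_cauchy_def
proof (intro allI impI)
  fix e :: real assume e: "e > 0"
  obtain M where M: "\<And>m n. m \<ge> M \<Longrightarrow> n \<ge> M \<Longrightarrow> padic_abs p (X m - X n) < e"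
    using assms(1) e unfolding padic_cauchy_def by blast
  obtain N where N: "\<And>m n. m \<ge> N \<Longrightarrow> n \<ge> N \<Longrightarrow> padic_abs p (Y m - Y n) < e"
    using assms(2) e unfolding padic_cauchy_def by blast
  have "padic_abs p (X m + Y m - (X n + Y n)) < e" if "m \<ge> max M N" "n \<ge> max M N" for m n
    using padic_abs_ultra[OF p, of "X m - X n" "Y m - Y n"] M[of m n] N[of m n] that
    by (simp add: add_diff_add)
  thus "\<exists>N. \<forall>m\<ge>N. \<forall>n\<ge>N. padic_abs p (X m + Y m - (X n + Y n)) < e" by blast
qed

lemma padic_cauchy_convergent:
  assumes "padic_cauchy p X"
  shows "convergent (\<lambda>n. padic_abs p (X n))"
proof -
  have "Cauchy (\<lambda>n. padic_abs p (X n))"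
    unfolding Cauchy_def
  proof (intro allI impI)
    fix e :: real assume "e > 0"
    then obtain N where N: "\<And>m n. m \<ge> N \<Longrightarrow> n \<ge> N \<Longrightarrow> padic_abs p (X m - X n) < e"
      using assms unfolding padic_cauchy_def by blast
    show "\<exists>M. \<forall>m\<ge>M. \<forall>n\<ge>M. dist (padic_abs p (X m)) (padic_abs p (X n)) < e"
      using N padic_abs_diff_ineq[OF p] by (metis dist_real_def order_le_less_trans)
  qed
  thus ?thesis by (simp add: Cauchy_convergent_iff)
qed

lemma padic_cauchy_bounded:
  assumes "padic_cauchy p X"
  obtains B where "B > 0" "\<And>n. padic_abs p (X n) \<le> B"
proof -
  have "Bseq (\<lambda>n. padic_abs p (X n))"
    using padic_cauchy_convergent[OF assms] by (rule convergent_imp_Bseq)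
  then obtain B where "B > 0" "\<forall>n. norm (padic_abs p (X n)) \<le> B" by (rule BseqE)
  thus ?thesis using that[of B] padic_abs_nonneg[OF p] by simp
qed

lemma padic_vanishes_mult:
  assumes "padic_cauchy p X" "padic_vanishes p Y"
  shows "padic_vanishes p (\<lambda>n. X n * Y n)"
proof -
  obtain B where B: "B > 0" "\<And>n. padic_abs p (X n) \<le> B"
    using padic_cauchy_bounded[OF assms(1)] by blast
  show ?thesis
    by (rule padic_vanishes_le[OF assms(2), of _ B])
      (simp add: padic_abs_mult[OF p] mult_right_mono B padic_abs_nonneg[OF p])
qed

lemma padic_cauchy_mult:
  assumes "padic_cauchy p X" "padic_cauchy p Y"
  shows "padic_cauchy p (\<lambda>n. X n * Y n)"
  unfolding padic_cauchy_def
proof (intro allI impI)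
  fix e :: real assume e: "e > 0"
  obtain A where A: "A > 0" "\<And>n. padic_abs p (X n) \<le> A"
    using padic_cauchy_bounded[OF assms(1)] by blast
  obtain B where B: "B > 0" "\<And>n. padic_abs p (Y n) \<le> B"
    using padic_cauchy_bounded[OF assms(2)] by blast
  obtain M where M: "\<And>m n. m \<ge> M \<Longrightarrow> n \<ge> M \<Longrightarrow> padic_abs p (X m - X n) < e / B"
    using assms(1) divide_pos_pos[OF e B(1)] unfolding padic_cauchy_def by blast
  obtain N where N: "\<And>m n. m \<ge> N \<Longrightarrow> n \<ge> N \<Longrightarrow> padic_abs p (Y m - Y n) < e / A"
    using assms(2) divide_pos_pos[OF e A(1)] unfolding padic_cauchy_def by blast
  have "padic_abs p (X m * Y m - X n * Y n) < e" if "m \<ge> max M N" "n \<ge> max M N" for m n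
  proof -
    have "padic_abs p (X m) * padic_abs p (Y m - Y n) \<le> A * padic_abs p (Y m - Y n)"
      by (intro mult_right_mono A padic_abs_nonneg[OF p])
    also have "\<dots> < e" using N[of m n] that A(1) by (simp add: field_simps)
    finally have 1: "padic_abs p (X m * (Y m - Y n)) < e"
      by (simp add: padic_abs_mult[OF p])
    have "padic_abs p (X m - X n) * padic_abs p (Y n) \<le> padic_abs p (X m - X n) * B"
      by (intro mult_left_mono B padic_abs_nonneg[OF p])
    also have "\<dots> < e" using M[of m n] that B(1) by (simp add: field_simps)
    finally have 2: "padic_abs p ((X m - X n) * Y n) < e"
      by (simp add: padic_abs_mult[OF p])
    show ?thesis
      unfolding mult_diff_mult
      using padic_abs_ultra[OF p, of "X m * (Y m - Y n)" "(X m - X n) * Y n"] 1 2 by simp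
  qed
  thus "\<exists>N. \<forall>m\<ge>N. \<forall>n\<ge>N. padic_abs p (X m * Y m - X n * Y n) < e" by blast
qed

lemma padic_cauchy_not_vanishes:
  assumes "padic_cauchy p X" "\<not> padic_vanishes p X"
  obtains b N where "b > 0" "\<And>n. n \<ge> N \<Longrightarrow> padic_abs p (X n) > b"
proof -
  obtain L where L: "(\<lambda>n. padic_abs p (X n)) \<longlonglongrightarrow> L"
    using padic_cauchy_convergent[OF assms(1)] by (auto simp: convergent_def)
  have "L \<ge> 0" by (rule LIMSEQ_le_const[OF L]) (use padic_abs_nonneg[OF p] in auto)
  moreover have "L \<noteq> 0" using L assms(2) by (auto simp: padic_vanishes_def)
  ultimately have L2: "L / 2 < L" "L / 2 > 0" by auto
  obtain N where "\<And>n. n \<ge> N \<Longrightarrow> padic_abs p (X n) > L / 2"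
    using order_tendstoD(1)[OF L L2(1)] unfolding eventually_sequentially by blast
  thus ?thesis using that L2(2) by blast
qed

lemma padic_cauchy_inverse:
  assumes "padic_cauchy p X" "\<not> padic_vanishes p X"
  shows "padic_cauchy p (\<lambda>n. inverse (X n))"
  unfolding padic_cauchy_def
proof (intro allI impI)
  fix e :: real assume e: "e > 0"
  obtain b K where b: "b > 0" "\<And>n. n \<ge> K \<Longrightarrow> padic_abs p (X n) > b"
    using padic_cauchy_not_vanishes[OF assms] by blast
  have "e * b * b > 0" using e b by simp
  then obtain N where N: "\<And>m n. m \<ge> N \<Longrightarrow> n \<ge> N \<Longrightarrow> padic_abs p (X m - X n) < e * b * b"
    using assms(1) unfolding padic_cauchy_def by blast
  have "padic_abs p (inverse (X m) - inverse (X n)) < e"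
    if "m \<ge> max K N" "n \<ge> max K N" for m n
  proof -
    have bm: "padic_abs p (X m) > b" and bn: "padic_abs p (X n) > b" using b that by auto
    have nz: "X m \<noteq> 0" "X n \<noteq> 0" using bm bn b(1) padic_abs_zero[OF p] by auto
    have "b * b \<le> padic_abs p (X m) * padic_abs p (X n)"
      using bm bn b(1) by (intro mult_mono) auto
    hence "e * (b * b) \<le> e * (padic_abs p (X m) * padic_abs p (X n))"
      using e by simp
    hence *: "padic_abs p (X m - X n) < e * (padic_abs p (X m) * padic_abs p (X n))"
      using N[of m n] that by (simp add: mult.assoc)
    have pos: "padic_abs p (X m) * padic_abs p (X n) > 0" using bm bn b(1) by simp
    have "padic_abs p (inverse (X m) - inverse (X n)) =
        padic_abs p (X m - X n) / (padic_abs p (X m) * padic_abs p (X n))"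
      unfolding inverse_diff_inverse[OF nz] padic_abs_uminus[OF p] padic_abs_mult[OF p]
        padic_abs_inverse[OF p] by (simp add: divide_inverse)
    also have "\<dots> < e" using * pos by (simp add: pos_divide_less_eq)
    finally show ?thesis .
  qed
  thus "\<exists>N. \<forall>m\<ge>N. \<forall>n\<ge>N. padic_abs p (inverse (X m) - inverse (X n)) < e" by blast
qed

lemma padic_rel_refl: "padic_rel p X X \<longleftrightarrow> padic_cauchy p X"
  by (auto simp: padic_rel_def padic_vanishes_const)

lemma padic_rel_sym: "padic_rel p X Y \<Longrightarrow> padic_rel p Y X"
  using padic_vanishes_minus[of "\<lambda>n. X n - Y n"] by (auto simp: padic_rel_def)

lemma padic_rel_trans: "padic_rel p X Y \<Longrightarrow> padic_rel p Y Z \<Longrightarrow> padic_rel p X Z"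
  using padic_vanishes_add[of "\<lambda>n. X n - Y n" "\<lambda>n. Y n - Z n"] by (auto simp: padic_rel_def)

lemma padic_rel_add:
  assumes "padic_rel p X X'" "padic_rel p Y Y'"
  shows "padic_rel p (\<lambda>n. X n + Y n) (\<lambda>n. X' n + Y' n)"
  using assms by (simp add: padic_rel_def padic_cauchy_add padic_vanishes_add add_diff_add)

lemma padic_rel_minus: "padic_rel p X X' \<Longrightarrow> padic_rel p (\<lambda>n. - X n) (\<lambda>n. - X' n)"
  using padic_vanishes_minus[of "\<lambda>n. X n - X' n"]
  by (simp add: padic_rel_def padic_cauchy_minus)

lemma padic_rel_mult:
  assumes "padic_rel p X X'" "padic_rel p Y Y'"
  shows "padic_rel p (\<lambda>n. X n * Y n) (\<lambda>n. X' n * Y' n)"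
proof -
  have "padic_vanishes p (\<lambda>n. X n * (Y n - Y' n) + Y' n * (X n - X' n))"
    using assms unfolding padic_rel_def
    by (intro padic_vanishes_add padic_vanishes_mult) auto
  thus ?thesis
    using assms by (simp add: padic_rel_def padic_cauchy_mult algebra_simps)
qed

lemma padic_rel_vanishes: "padic_rel p X Y \<Longrightarrow> padic_vanishes p X \<longleftrightarrow> padic_vanishes p Y"
  using padic_vanishes_add[of "\<lambda>n. X n - Y n" Y] 
    padic_vanishes_add[of "\<lambda>n. - (X n - Y n)" X] padic_vanishes_minus[of "\<lambda>n. X n - Y n"]
  by (auto simp: padic_rel_def)

lemma padic_rel_inverse:
  assumes "padic_rel p X Y" "\<not> padic_vanishes p X"
  shows "padic_rel p (\<lambda>n. inverse (X n)) (\<lambda>n. inverse (Y n))"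
proof -
  have c: "padic_cauchy p X" "padic_cauchy p Y" using assms by (auto simp: padic_rel_def)
  have nY: "\<not> padic_vanishes p Y" using padic_rel_vanishes assms by blast
  note iX = padic_cauchy_inverse[OF c(1) assms(2)]
  note iY = padic_cauchy_inverse[OF c(2) nY]
  obtain a M where a: "a > 0" "\<And>n. n \<ge> M \<Longrightarrow> padic_abs p (X n) > a"
    using padic_cauchy_not_vanishes[OF c(1) assms(2)] by blast
  obtain b N where b: "b > 0" "\<And>n. n \<ge> N \<Longrightarrow> padic_abs p (Y n) > b"
    using padic_cauchy_not_vanishes[OF c(2) nY] by blast
  have "padic_vanishes p (\<lambda>n. (inverse (X n) * inverse (Y n)) * (- (X n - Y n)))"
    using assms(1) unfolding padic_rel_def
    by (intro padic_vanishes_mult padic_cauchy_mult iX iY padic_vanishes_minus) auto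
  moreover have "eventually (\<lambda>n. padic_abs p (inverse (X n) * inverse (Y n) * (- (X n - Y n)))
      = padic_abs p (inverse (X n) - inverse (Y n))) sequentially"
    using eventually_ge_at_top[of "max M N"]
  proof eventually_elim
    case (elim n)
    have "padic_abs p (X n) > a" "padic_abs p (Y n) > b" using a b elim by auto
    hence "X n \<noteq> 0" "Y n \<noteq> 0" using a(1) b(1) padic_abs_zero[OF p] by auto
    hence "inverse (X n) * inverse (Y n) * (- (X n - Y n)) = inverse (X n) - inverse (Y n)"
      by (simp add: field_simps)
    thus ?case by (simp only:)
  qed
  ultimately have "padic_vanishes p (\<lambda>n. inverse (X n) - inverse (Y n))"
    unfolding padic_vanishes_def by (rule Lim_transform_eventually)
  thus ?thesis using iX iY by (simp add: padic_rel_def)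
qed

lemma padic_rel_lim:
  assumes "padic_rel p X Y"
  shows "lim (\<lambda>n. padic_abs p (X n)) = lim (\<lambda>n. padic_abs p (Y n))"
proof -
  have "convergent (\<lambda>n. padic_abs p (Y n))"
    using assms padic_cauchy_convergent by (simp add: padic_rel_def)
  hence Y: "(\<lambda>n. padic_abs p (Y n)) \<longlonglongrightarrow> lim (\<lambda>n. padic_abs p (Y n))"
    by (simp add: convergent_LIMSEQ_iff)
  have "(\<lambda>n. padic_abs p (X n) - padic_abs p (Y n)) \<longlonglongrightarrow> 0"
    by (rule Lim_null_comparison[where g = "\<lambda>n. padic_abs p (X n - Y n)"])
      (use assms padic_abs_diff_ineq[OF p] in \<open>auto simp: padic_rel_def padic_vanishes_def\<close>)
  hence "(\<lambda>n. padic_abs p (X n)) \<longlonglongrightarrow> lim (\<lambda>n. padic_abs p (Y n))"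
    using tendsto_add[OF _ Y] by fastforce
  thus ?thesis by (rule limI)
qed

end


section \<open>The field of p-adic numbers\<close>

text \<open>
  The completion of the rationals with respect to the p-adic absolute value. The prime is
  \<^term>\<open>CARD('p)\<close> for a type variable \<^typ>\<open>'p::prime_card\<close>, so that it is arbitrary. Cauchy
  sequences get a type of their own because the quotient command does not accept a
  representation type in which \<^typ>\<open>'p::prime_card\<close> does not occur.
\<close>

typedef (overloaded) ('p::prime_card) padic_seq = "{X. padic_cauchy CARD('p) X}"
  by (rule exI[of _ "\<lambda>n. 0"]) (simp add: padic_cauchy_const[OF prime_card])

setup_lifting type_definition_padic_seq

lift_definition padic_seq_eq :: "'p::prime_card padic_seq \<Rightarrow> 'p padic_seq \<Rightarrow> bool" is
  "\<lambda>X Y. padic_vanishes CARD('p) (\<lambda>n. X n - Y n)" .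

lemma padic_seq_eq_iff_rel:
  "padic_seq_eq X Y \<longleftrightarrow> padic_rel CARD('p::prime_card) (Rep_padic_seq X) (Rep_padic_seq (Y :: 'p padic_seq))"
  using Rep_padic_seq[of X] Rep_padic_seq[of Y]
  by (simp add: padic_seq_eq.rep_eq padic_rel_def)

lemma equivp_padic_seq_eq: "equivp padic_seq_eq"
proof (intro equivpI reflpI sympI transpI)
  fix X Y Z :: "'a padic_seq"
  show "padic_seq_eq X X"
    by transfer (simp add: padic_vanishes_const[OF prime_card])
  show "padic_seq_eq X Y \<Longrightarrow> padic_seq_eq Y X"
    unfolding padic_seq_eq_iff_rel by (rule padic_rel_sym[OF prime_card])
  show "padic_seq_eq X Y \<Longrightarrow> padic_seq_eq Y Z \<Longrightarrow> padic_seq_eq X Z"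
    unfolding padic_seq_eq_iff_rel by (rule padic_rel_trans[OF prime_card])
qed

quotient_type (overloaded) 'p padic = "'p::prime_card padic_seq" / padic_seq_eq
  by (rule equivp_padic_seq_eq)

lift_definition seq_zero :: "'p::prime_card padic_seq" is "\<lambda>n. 0"
  by (simp add: padic_cauchy_const[OF prime_card])

lift_definition seq_one :: "'p::prime_card padic_seq" is "\<lambda>n. 1"
  by (simp add: padic_cauchy_const[OF prime_card])

lift_definition seq_plus :: "'p::prime_card padic_seq \<Rightarrow> 'p padic_seq \<Rightarrow> 'p padic_seq" is
  "\<lambda>X Y n. X n + Y n" by (rule padic_cauchy_add[OF prime_card])

lift_definition seq_uminus :: "'p::prime_card padic_seq \<Rightarrow> 'p padic_seq" is
  "\<lambda>X n. - X n" by (rule padic_cauchy_minus[OF prime_card])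

lift_definition seq_times :: "'p::prime_card padic_seq \<Rightarrow> 'p padic_seq \<Rightarrow> 'p padic_seq" is
  "\<lambda>X Y n. X n * Y n" by (rule padic_cauchy_mult[OF prime_card])

lift_definition seq_inverse :: "'p::prime_card padic_seq \<Rightarrow> 'p padic_seq" is
  "\<lambda>X. if padic_vanishes CARD('p) X then (\<lambda>n. 0) else (\<lambda>n. inverse (X n))"
  using padic_cauchy_inverse[OF prime_card]
  by (auto simp: padic_cauchy_const[OF prime_card])

lift_definition seq_norm :: "'p::prime_card padic_seq \<Rightarrow> real" is
  "\<lambda>X. lim (\<lambda>n. padic_abs CARD('p) (X n))" .

instantiation padic :: (prime_card) field
begin

lift_definition zero_padic :: "'a padic" is seq_zero .

lift_definition one_padic :: "'a padic" is seq_one .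

lift_definition plus_padic :: "'a padic \<Rightarrow> 'a padic \<Rightarrow> 'a padic" is seq_plus
  unfolding padic_seq_eq_iff_rel seq_plus.rep_eq by (rule padic_rel_add[OF prime_card])

lift_definition uminus_padic :: "'a padic \<Rightarrow> 'a padic" is seq_uminus
  unfolding padic_seq_eq_iff_rel seq_uminus.rep_eq by (rule padic_rel_minus[OF prime_card])

lift_definition times_padic :: "'a padic \<Rightarrow> 'a padic \<Rightarrow> 'a padic" is seq_times
  unfolding padic_seq_eq_iff_rel seq_times.rep_eq by (rule padic_rel_mult[OF prime_card])

lift_definition inverse_padic :: "'a padic \<Rightarrow> 'a padic" is seq_inverse
  unfolding padic_seq_eq_iff_rel seq_inverse.rep_eq
  using padic_rel_vanishes[OF prime_card] padic_rel_inverse[OF prime_card]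
  by (auto simp: padic_rel_refl[OF prime_card] padic_cauchy_const[OF prime_card])

definition minus_padic :: "'a padic \<Rightarrow> 'a padic \<Rightarrow> 'a padic" where
  "minus_padic x y = x + - y"

definition divide_padic :: "'a padic \<Rightarrow> 'a padic \<Rightarrow> 'a padic" where
  "divide_padic x y = x * inverse y"

instance
proof
  fix a b c :: "'a padic"
  note refl = padic_vanishes_const[OF prime_card]
  show "a + b + c = a + (b + c)" by transfer (transfer, simp add: refl)
  show "a + b = b + a" by transfer (transfer, simp add: refl)
  show "0 + a = a" by transfer (transfer, simp add: refl)
  show "- a + a = 0" by transfer (transfer, simp add: refl)
  show "a - b = a + - b" by (rule minus_padic_def)
  show "a * b * c = a * (b * c)" by transfer (transfer, simp add: refl)
  show "a * b = b * a" by transfer (transfer, simp add: refl mult.commute)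
  show "1 * a = a" by transfer (transfer, simp add: refl)
  show "(a + b) * c = a * c + b * c"
    by transfer (transfer, simp add: refl distrib_right)
  show "(0 :: 'a padic) \<noteq> 1" by transfer (transfer, simp add: refl)
  show "inverse (0 :: 'a padic) = 0" by transfer (transfer, simp add: refl)
  show "a div b = a * inverse b" by (rule divide_padic_def)
  show "a \<noteq> 0 \<Longrightarrow> inverse a * a = 1"
  proof (transfer, transfer)
    fix X :: "nat \<Rightarrow> rat"
    assume cX: "padic_cauchy CARD('a) X" and "\<not> padic_vanishes CARD('a) (\<lambda>n. X n - 0)"
    hence nX: "\<not> padic_vanishes CARD('a) X" by simp
    obtain b N where b: "b > 0" "\<And>n. n \<ge> N \<Longrightarrow> padic_abs CARD('a) (X n) > b"
      using padic_cauchy_not_vanishes[OF prime_card cX nX] by blast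
    have "eventually (\<lambda>n. padic_abs CARD('a) (inverse (X n) * X n - 1) = 0) sequentially"
      using eventually_ge_at_top[of N]
    proof eventually_elim
      case (elim n)
      have "X n \<noteq> 0"
        using b(1) b(2)[OF elim] padic_abs_zero[OF prime_card[where 'a = 'a]] by auto
      thus ?case by (simp add: padic_abs_zero[OF prime_card])
    qed
    hence "padic_vanishes CARD('a) (\<lambda>n. inverse (X n) * X n - 1)"
      unfolding padic_vanishes_def by (rule tendsto_eventually)
    thus "padic_vanishes CARD('a) (\<lambda>n. (if padic_vanishes CARD('a) X then (\<lambda>n. 0)
        else (\<lambda>n. inverse (X n))) n * X n - 1)"
      using nX by simp
  qed
qed

end

lift_definition padic_norm :: "'p::prime_card padic \<Rightarrow> real" is seq_norm
  unfolding padic_seq_eq_iff_rel seq_norm.rep_eq by (rule padic_rel_lim[OF prime_card])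

lemma tendsto_padic_norm:
  assumes "padic_cauchy p X" "prime p"
  shows "(\<lambda>n. padic_abs p (X n)) \<longlonglongrightarrow> lim (\<lambda>n. padic_abs p (X n))"
  using padic_cauchy_convergent[OF assms(2,1)] by (simp add: convergent_LIMSEQ_iff)

lemma padic_norm_eq_0_iff: "padic_norm x = 0 \<longleftrightarrow> x = 0"
proof (transfer, transfer)
  fix X :: "nat \<Rightarrow> rat"
  assume X: "padic_cauchy CARD('a) X"
  show "lim (\<lambda>n. padic_abs CARD('a) (X n)) = 0 \<longleftrightarrow> padic_vanishes CARD('a) (\<lambda>n. X n - 0)"
    using tendsto_padic_norm[OF X prime_card]
    by (auto simp: padic_vanishes_def dest: limI)
qed

lemma padic_norm_minus: "padic_norm (- x) = padic_norm x"
  by transfer (transfer, simp add: padic_abs_uminus[OF prime_card])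

lemma padic_norm_triangle: "padic_norm (x + y) \<le> padic_norm x + padic_norm y"
proof (transfer, transfer)
  fix X Y :: "nat \<Rightarrow> rat"
  assume X: "padic_cauchy CARD('a) X" and Y: "padic_cauchy CARD('a) Y"
  show "lim (\<lambda>n. padic_abs CARD('a) (X n + Y n)) \<le>
      lim (\<lambda>n. padic_abs CARD('a) (X n)) + lim (\<lambda>n. padic_abs CARD('a) (Y n))"
    by (rule LIMSEQ_le[OF tendsto_padic_norm[OF padic_cauchy_add[OF prime_card X Y] prime_card]
          tendsto_add[OF tendsto_padic_norm[OF X prime_card] tendsto_padic_norm[OF Y prime_card]]])
      (use padic_abs_triangle[OF prime_card] in blast)
qed

instantiation padic :: (prime_card) metric_space
begin

definition dist_padic :: "'a padic \<Rightarrow> 'a padic \<Rightarrow> real" where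
  "dist_padic x y = padic_norm (x - y)"

definition uniformity_padic :: "('a padic \<times> 'a padic) filter" where
  "uniformity_padic = (INF e\<in>{0<..}. principal {(x, y). dist x y < e})"

definition open_padic :: "'a padic set \<Rightarrow> bool" where
  "open_padic U \<longleftrightarrow> (\<forall>x\<in>U. \<forall>\<^sub>F (x', y) in uniformity. x' = x \<longrightarrow> y \<in> U)"

instance
proof
  fix x y z :: "'a padic"
  show "dist x y = 0 \<longleftrightarrow> x = y" by (simp add: dist_padic_def padic_norm_eq_0_iff)
  have "dist x y = padic_norm ((x - z) + - (y - z))" by (simp add: dist_padic_def)
  also have "\<dots> \<le> padic_norm (x - z) + padic_norm (- (y - z))" by (rule padic_norm_triangle)
  finally show "dist x y \<le> dist x z + dist y z"
    by (simp only: dist_padic_def padic_norm_minus)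
qed (simp_all add: uniformity_padic_def open_padic_def)

end

definition padic_integers :: "'p::prime_card padic set" where
  "padic_integers = {x. padic_norm x \<le> 1}"


section \<open>Haar measure\<close>

definition regular_borel_measure :: "'a::topological_space measure \<Rightarrow> bool" where
  "regular_borel_measure \<mu> \<longleftrightarrow>
     sets \<mu> = sets borel \<and>
     (\<forall>K. compact K \<longrightarrow> emeasure \<mu> K < \<infinity>) \<and>
     (\<forall>A\<in>sets borel. emeasure \<mu> A = (INF U\<in>{U. open U \<and> A \<subseteq> U}. emeasure \<mu> U)) \<and>
     (\<forall>U. open U \<longrightarrow> emeasure \<mu> U = (SUP K\<in>{K. compact K \<and> K \<subseteq> U}. emeasure \<mu> K))"

text \<open>
  There is exactly one such measure, so that a hypothesis
  \<^prop>\<open>padic_haar_measure \<mu>\<close> names the Haar measure.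
\<close>

definition padic_haar_measure :: "'p::prime_card padic measure \<Rightarrow> bool" where
  "padic_haar_measure \<mu> \<longleftrightarrow>
     regular_borel_measure \<mu> \<and>
     (\<forall>a. \<forall>A\<in>sets borel. emeasure \<mu> ((+) a ` A) = emeasure \<mu> A) \<and>
     emeasure \<mu> padic_integers = 1"


section \<open>Roots\<close>

definition root_count :: "'a::idom poly \<Rightarrow> nat" where
  "root_count f = card {x. poly f x = 0}"

end

theory Submission
  imports Defs
begin

text \<open>
  A monic polynomial f with p-adic integer coefficients has all its roots in the unit ball. For
  large k these roots lie in different cosets of \<^term>\<open>padic_ideal k\<close>, so the number of roots is the
  limit of the number of the cosets a + \<^term>\<open>padic_ideal k\<close>, with a running through the
  residues modulo the k-th power of p, that contain a root. The expectation of the latter number is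
  a finite sum of probabilities, and by dominated convergence (the degree is a bound) these
  expectations converge to the one wanted.

  For a fixed integer a the value f(a) is the constant coefficient plus a function of the
  other coefficients, and the derivative f'(a) is the linear coefficient plus a function of the
  later ones. Therefore f(a) and f'(a) are independent and both Haar distributed; this is
  \<open>prob_value_deriv\<close>, and it is where the degree has to be at least 2. Hensel's lemma in
  the form of \<open>hensel_coset\<close> and \<open>value_at_centre_of_root_coset\<close> says that, when f'(a) has
  valuation j < k, the coset of a contains a root if and only if f(a) has valuation at least k + j.
  With q = 1/p this event has probability \<open>q^(k + j) * (q^j - q^(j + 1))\<close>. When the
  valuation of f'(a) is at least k, a root forces that of f(a) to be at least 2k, which has
  probability at most \<open>q^(3 * k)\<close>. Multiplying by the number of cosets gives
  \<open>(1 - q) * (\<Sum>j<k. q^(2 * j))\<close> up to an error of at most \<open>q^(2 * k)\<close>, and this tends to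
  \<open>(1 - q) / (1 - q^2) = 1 / (1 + q) = p / (p + 1)\<close>.

  Compactness of the ring of p-adic integers serves twice. It yields Hensel's lemma, through a point
  at which the norm of f is minimal, and it makes the existence of a root in a coset a condition on
  the values at countably many integers, whence it is an event.
\<close>

section \<open>The norm on the p-adic numbers\<close>

lemma padic_norm_mult: "padic_norm (x * y) = padic_norm x * padic_norm y"
proof (transfer, transfer)
  fix X Y :: "nat \<Rightarrow> rat"
  assume X: "padic_cauchy CARD('a) X" and Y: "padic_cauchy CARD('a) Y"
  have "(\<lambda>n. padic_abs CARD('a) (X n * Y n)) \<longlonglongrightarrow>
      lim (\<lambda>n. padic_abs CARD('a) (X n)) * lim (\<lambda>n. padic_abs CARD('a) (Y n))"
    unfolding padic_abs_mult[OF prime_card]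
    by (intro tendsto_mult tendsto_padic_norm X Y prime_card)
  thus "lim (\<lambda>n. padic_abs CARD('a) (X n * Y n)) =
      lim (\<lambda>n. padic_abs CARD('a) (X n)) * lim (\<lambda>n. padic_abs CARD('a) (Y n))"
    by (rule limI)
qed

lemma padic_norm_ultra: "padic_norm (x + y) \<le> max (padic_norm x) (padic_norm y)"
proof (transfer, transfer)
  fix X Y :: "nat \<Rightarrow> rat"
  assume X: "padic_cauchy CARD('a) X" and Y: "padic_cauchy CARD('a) Y"
  show "lim (\<lambda>n. padic_abs CARD('a) (X n + Y n)) \<le>
      max (lim (\<lambda>n. padic_abs CARD('a) (X n))) (lim (\<lambda>n. padic_abs CARD('a) (Y n)))"
    by (rule LIMSEQ_le[OF tendsto_padic_norm[OF padic_cauchy_add[OF prime_card X Y] prime_card]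
          tendsto_max[OF tendsto_padic_norm[OF X prime_card] tendsto_padic_norm[OF Y prime_card]]])
      (use padic_abs_ultra[OF prime_card] in blast)
qed

lemma padic_norm_zero [simp]: "padic_norm 0 = 0"
  by (simp add: padic_norm_eq_0_iff)

lemma padic_norm_nonneg [simp]: "padic_norm x \<ge> 0"
  using padic_norm_triangle[of x "- x"] by (simp add: padic_norm_minus)

lemma padic_norm_one [simp]: "padic_norm 1 = 1"
  using padic_norm_mult[of "1 :: 'a padic" 1] padic_norm_eq_0_iff[of "1 :: 'a padic"] by simp

lemma padic_norm_power: "padic_norm (x ^ n) = padic_norm x ^ n"
  by (induction n) (simp_all add: padic_norm_mult)

lemma padic_norm_inverse: "padic_norm (inverse x) = inverse (padic_norm x)"
proof (cases "x = 0")
  case False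
  have "padic_norm x * padic_norm (inverse x) = 1"
    using False by (simp flip: padic_norm_mult)
  thus ?thesis by (metis inverse_unique)
qed simp

lemma padic_norm_divide: "padic_norm (x / y) = padic_norm x / padic_norm y"
  by (simp add: divide_inverse padic_norm_mult padic_norm_inverse)

lemma padic_norm_minus_commute: "padic_norm (x - y) = padic_norm (y - x)"
  using padic_norm_minus[of "x - y"] by simp

lemma padic_norm_diff_ineq: "\<bar>padic_norm x - padic_norm y\<bar> \<le> padic_norm (x - y)"
  using padic_norm_triangle[of "x - y" y] padic_norm_triangle[of "y - x" x]
    padic_norm_minus_commute[of x y] by simp

lift_definition const_seq :: "rat \<Rightarrow> 'p::prime_card padic_seq" is "\<lambda>r n. r"
  by (simp add: padic_cauchy_const[OF prime_card])

lift_definition padic_of_rat :: "rat \<Rightarrow> 'p::prime_card padic" is const_seq .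

lemma padic_of_rat_0: "padic_of_rat 0 = 0"
  by transfer (transfer, simp add: padic_vanishes_const[OF prime_card])

lemma padic_of_rat_1: "padic_of_rat 1 = 1"
  by transfer (transfer, simp add: padic_vanishes_const[OF prime_card])

lemma padic_of_rat_diff: "padic_of_rat (r - s) = padic_of_rat r - padic_of_rat s"
  unfolding minus_padic_def
  by transfer (transfer, simp add: padic_vanishes_const[OF prime_card])

lemma padic_of_rat_of_int: "padic_of_rat (of_int z) = (of_int z :: 'p::prime_card padic)"
proof (induction z rule: int_induct[where k = 0])
  case (step1 z)
  have "padic_of_rat (of_int (z + 1) - 1) = padic_of_rat (of_int (z + 1)) - (1 :: 'p padic)"
    unfolding padic_of_rat_diff padic_of_rat_1 ..
  hence "padic_of_rat (of_int (z + 1)) = padic_of_rat (of_int z) + (1 :: 'p padic)"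
    by (simp add: eq_diff_eq)
  thus ?case by (simp add: step1(2))
next
  case (step2 z)
  have "padic_of_rat (of_int z - 1) = padic_of_rat (of_int z) - (1 :: 'p padic)"
    unfolding padic_of_rat_diff padic_of_rat_1 ..
  thus ?case using step2 by simp
qed (simp add: padic_of_rat_0)

lemma padic_norm_of_rat: "padic_norm (padic_of_rat r :: 'p::prime_card padic) = padic_abs CARD('p) r"
  by transfer (transfer, simp)

lemma tendsto_norm_diff_rat:
  fixes C :: "'p::prime_card padic_seq"
  shows "(\<lambda>m. padic_abs CARD('p) (Rep_padic_seq C m - r)) \<longlonglongrightarrow> padic_norm (abs_padic C - padic_of_rat r)"
proof -
  have C: "padic_cauchy CARD('p) (Rep_padic_seq C)" using Rep_padic_seq[of C] by simp
  have "padic_norm (abs_padic C - padic_of_rat r) = lim (\<lambda>m. padic_abs CARD('p) (Rep_padic_seq C m - r))"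
    unfolding minus_padic_def padic_of_rat.abs_eq uminus_padic.abs_eq plus_padic.abs_eq
      padic_norm.abs_eq seq_norm.rep_eq seq_plus.rep_eq seq_uminus.rep_eq const_seq.rep_eq
    by simp
  moreover have "padic_cauchy CARD('p) (\<lambda>m. Rep_padic_seq C m + - r)"
    by (intro padic_cauchy_add padic_cauchy_const C prime_card)
  ultimately show ?thesis using tendsto_padic_norm[OF _ prime_card[where 'a = 'p]] by simp
qed

text \<open>
  Both the density of the rationals and the completeness of the p-adic numbers are consequences
  of the fact that a Cauchy sequence of rationals converges to the class that it represents.
\<close>

lemma padic_seq_tendsto_class:
  fixes C :: "'p::prime_card padic_seq"
  shows "(\<lambda>n. padic_norm (abs_padic C - padic_of_rat (Rep_padic_seq C n))) \<longlonglongrightarrow> 0"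
proof (rule LIMSEQ_I)
  let ?X = "Rep_padic_seq C"
  fix e :: real assume e: "e > 0"
  have "padic_cauchy CARD('p) ?X" using Rep_padic_seq[of C] by simp
  then obtain N where N: "\<And>m n. m \<ge> N \<Longrightarrow> n \<ge> N \<Longrightarrow> padic_abs CARD('p) (?X m - ?X n) < e / 2"
    using e unfolding padic_cauchy_def by (meson half_gt_zero)
  have "padic_norm (abs_padic C - padic_of_rat (?X n)) \<le> e / 2" if "n \<ge> N" for n
    by (rule LIMSEQ_le_const2[OF tendsto_norm_diff_rat]) (use N that less_imp_le in blast)
  thus "\<exists>N. \<forall>n\<ge>N. norm (padic_norm (abs_padic C - padic_of_rat (?X n)) - 0) < e"
    using e by (intro exI[of _ N]) fastforce
qed

lemma padic_of_rat_dense: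
  fixes x :: "'p::prime_card padic"
  assumes "e > 0"
  obtains r where "padic_norm (x - padic_of_rat r) < e"
proof -
  obtain C where "x = abs_padic C" by (metis Quotient3_abs_rep Quotient3_padic)
  hence "(\<lambda>n. padic_norm (x - padic_of_rat (Rep_padic_seq C n))) \<longlonglongrightarrow> 0"
    using padic_seq_tendsto_class by simp
  from order_tendstoD(2)[OF this assms] show ?thesis
    using that unfolding eventually_sequentially by blast
qed

lemma padic_cauchy_limit:
  assumes "padic_cauchy CARD('p::prime_card) X"
  obtains x :: "'p::prime_card padic" where "(\<lambda>n. padic_norm (x - padic_of_rat (X n))) \<longlonglongrightarrow> 0"
  using padic_seq_tendsto_class[of "Abs_padic_seq X :: 'p padic_seq"]
    Abs_padic_seq_inverse[where 'p = 'p and y = X] assms that by simp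


section \<open>The ideals generated by the powers of p\<close>

definition padic_ideal :: "nat \<Rightarrow> 'p::prime_card padic set" where
  "padic_ideal k = {x. padic_norm x \<le> 1 / real CARD('p) ^ k}"

lemma CARD_gt_1: "real CARD('p::prime_card) > 1"
  using prime_gt_1_nat[OF prime_card[where 'a = 'p]] by simp

lemma padic_ideal_0: "padic_ideal 0 = padic_integers"
  by (simp add: padic_ideal_def padic_integers_def)

lemma padic_ideal_mono: "x \<in> padic_ideal l \<Longrightarrow> k \<le> l \<Longrightarrow> x \<in> padic_ideal k"
proof -
  assume "x \<in> padic_ideal l" "k \<le> l"
  moreover have "1 / real CARD('a) ^ l \<le> 1 / real CARD('a) ^ k"
    using CARD_gt_1[where 'p = 'a] \<open>k \<le> l\<close> by (intro divide_left_mono power_increasing) auto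
  ultimately show ?thesis unfolding padic_ideal_def by (auto intro: order_trans)
qed

lemma padic_ideal_subset_integers: "x \<in> padic_ideal k \<Longrightarrow> x \<in> padic_integers"
  using padic_ideal_mono[of x k 0] by (simp add: padic_ideal_0)

lemma zero_in_padic_ideal [simp]: "0 \<in> padic_ideal k"
  by (simp add: padic_ideal_def)

lemma padic_ideal_add: "x \<in> padic_ideal k \<Longrightarrow> y \<in> padic_ideal k \<Longrightarrow> x + y \<in> padic_ideal k"
  using padic_norm_ultra[of x y] by (auto simp: padic_ideal_def)

lemma padic_ideal_uminus: "x \<in> padic_ideal k \<Longrightarrow> - x \<in> padic_ideal k"
  by (simp add: padic_ideal_def padic_norm_minus)

lemma padic_ideal_diff: "x \<in> padic_ideal k \<Longrightarrow> y \<in> padic_ideal k \<Longrightarrow> x - y \<in> padic_ideal k"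
  using padic_ideal_add[OF _ padic_ideal_uminus] by fastforce

lemma padic_ideal_diff_commute: "x - y \<in> padic_ideal k \<longleftrightarrow> y - x \<in> padic_ideal k"
  by (simp add: padic_ideal_def padic_norm_minus_commute[of x y])

lemma padic_ideal_cong: "x - y \<in> padic_ideal k \<Longrightarrow> x \<in> padic_ideal k \<longleftrightarrow> y \<in> padic_ideal k"
  using padic_ideal_diff[of x k "x - y"] padic_ideal_add[of "x - y" k y] by auto

lemma padic_ideal_mult: "x \<in> padic_ideal k \<Longrightarrow> y \<in> padic_ideal l \<Longrightarrow> x * y \<in> padic_ideal (k + l)"
  using mult_mono[of "padic_norm x" "1 / real CARD('a) ^ k" "padic_norm y" "1 / real CARD('a) ^ l"]
  by (simp add: padic_ideal_def padic_norm_mult power_add)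

lemma padic_ideal_mult_integer: "x \<in> padic_integers \<Longrightarrow> y \<in> padic_ideal k \<Longrightarrow> x * y \<in> padic_ideal k"
  using padic_ideal_mult[of x 0 y k] by (simp add: padic_ideal_0)

lemma padic_integers_1 [simp]: "1 \<in> padic_integers"
  by (simp add: padic_integers_def)

lemma padic_integers_0 [simp]: "0 \<in> padic_integers"
  by (simp add: padic_integers_def)

lemma padic_integers_add: "x \<in> padic_integers \<Longrightarrow> y \<in> padic_integers \<Longrightarrow> x + y \<in> padic_integers"
  using padic_ideal_add[of x 0 y] by (simp add: padic_ideal_0)

lemma padic_integers_mult: "x \<in> padic_integers \<Longrightarrow> y \<in> padic_integers \<Longrightarrow> x * y \<in> padic_integers"
  using padic_ideal_mult_integer[of x y 0] by (simp add: padic_ideal_0)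

lemma inverse_power_less:
  assumes "e > 0"
  obtains m where "1 / real CARD('p::prime_card) ^ m < e"
  using real_arch_pow_inv[OF assms, of "1 / real CARD('p)"] CARD_gt_1[where 'p = 'p]
  by (auto simp: power_one_over field_simps)

lemma eq_0_if_in_all_padic_ideals:
  fixes x :: "'p::prime_card padic"
  assumes "\<And>m. x \<in> padic_ideal m"
  shows "x = 0"
proof (rule ccontr)
  assume "x \<noteq> 0"
  hence "padic_norm x > 0" using padic_norm_nonneg[of x] padic_norm_eq_0_iff[of x] by linarith
  then obtain m where "1 / real CARD('p) ^ m < padic_norm x"
    using inverse_power_less by blast
  thus False using assms[of m] by (simp add: padic_ideal_def)
qed

lemma padic_abs_of_int:
  assumes "prime p" "z \<noteq> 0"
  shows "padic_abs p (of_int z) = 1 / real p ^ multiplicity (int p) z"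
  using padic_abs_frac[OF assms, of 1] by (simp add: power_int_minus field_simps)

lemma padic_abs_of_int_le_iff:
  assumes "prime p"
  shows "padic_abs p (of_int z) \<le> 1 / real p ^ k \<longleftrightarrow> int p ^ k dvd z"
proof (cases "z = 0")
  case False
  have p: "real p > 1" using prime_gt_1_nat[OF assms] by simp
  have "padic_abs p (of_int z) \<le> 1 / real p ^ k \<longleftrightarrow> real p ^ k \<le> real p ^ multiplicity (int p) z"
    using p by (simp add: padic_abs_of_int[OF assms False] field_simps)
  also have "\<dots> \<longleftrightarrow> k \<le> multiplicity (int p) z" using p by simp
  also have "\<dots> \<longleftrightarrow> int p ^ k dvd z"
    using False prime_gt_1_nat[OF assms] by (simp add: power_dvd_iff_le_multiplicity)
  finally show ?thesis .
qed (use prime_gt_0_nat[OF assms] in \<open>simp add: padic_abs_zero[OF assms]\<close>)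

lemma padic_norm_of_int: "padic_norm (of_int z :: 'p::prime_card padic) = padic_abs CARD('p) (of_int z)"
  by (simp flip: padic_of_rat_of_int add: padic_norm_of_rat)

lemma of_int_in_padic_ideal_iff:
  "(of_int z :: 'p::prime_card padic) \<in> padic_ideal k \<longleftrightarrow> int CARD('p) ^ k dvd z"
  by (simp add: padic_ideal_def padic_norm_of_int padic_abs_of_int_le_iff[OF prime_card])

lemma of_int_in_padic_integers [simp]: "of_int z \<in> padic_integers"
  using of_int_in_padic_ideal_iff[of z 0] by (simp add: padic_ideal_0)

text \<open>
  A rational number whose denominator is prime to p is congruent to an integer modulo every power
  of p, because the denominator can be inverted modulo that power.
\<close>

lemma padic_abs_approx_int:
  assumes p: "prime p" and r: "padic_abs p r \<le> 1"
  obtains z where "padic_abs p (r - of_int z) \<le> 1 / real p ^ m"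
proof (cases "r = 0")
  case True
  thus ?thesis using that[of 0] by (simp add: padic_abs_zero[OF p])
next
  case False
  obtain c d where cd: "quotient_of r = (c, d)" by fastforce
  have d: "d > 0" and cop: "coprime c d" and rcd: "r = of_int c / of_int d"
    using quotient_of_denom_pos[OF cd] quotient_of_coprime[OF cd] quotient_of_div[OF cd] by auto
  have c: "c \<noteq> 0" using rcd False by auto
  have p1: "real p > 1" using prime_gt_1_nat[OF p] by simp
  have "\<not> int p dvd d"
  proof
    assume dvd: "int p dvd d"
    hence "\<not> int p dvd c" using cop p
      by (metis coprime_common_divisor not_prime_unit prime_nat_int_transfer)
    hence "multiplicity (int p) c = 0" by (rule not_dvd_imp_multiplicity_0)
    moreover have "multiplicity (int p) d > 0"
      using dvd d p by (simp add: prime_multiplicity_gt_zero_iff)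
    ultimately have "padic_abs p r = real p ^ multiplicity (int p) d" "multiplicity (int p) d > 0"
      using padic_abs_frac[OF p c, of d] d by (auto simp: rcd)
    thus False using r p1 by (metis linorder_not_le one_less_power)
  qed
  hence md: "multiplicity (int p) d = 0" by (rule not_dvd_imp_multiplicity_0)
  have "coprime d (int p ^ m)"
    using \<open>\<not> int p dvd d\<close> p by (metis coprime_commute coprime_power_right_iff prime_imp_coprime prime_nat_int_transfer)
  then obtain e where "[d * e = 1] (mod int p ^ m)" using cong_solve_coprime_int by blast
  hence "int p ^ m dvd 1 - d * e" by (simp add: cong_iff_dvd_diff dvd_diff_commute)
  hence "int p ^ m dvd c * (1 - d * e)" by simp
  hence "padic_abs p (of_int (c * (1 - d * e))) \<le> 1 / real p ^ m"
    using padic_abs_of_int_le_iff[OF p] by blast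
  moreover have "r - of_int (c * e) = of_int (c * (1 - d * e)) * inverse (of_int d)"
    using d by (simp add: rcd field_simps)
  moreover have "padic_abs p (inverse (of_int d)) = 1"
    using d md by (simp add: padic_abs_inverse[OF p] padic_abs_of_int[OF p])
  ultimately have "padic_abs p (r - of_int (c * e)) \<le> 1 / real p ^ m"
    by (simp only: padic_abs_mult[OF p])
  thus ?thesis by (rule that)
qed

lemma padic_residue_exists:
  fixes x :: "'p::prime_card padic"
  assumes "x \<in> padic_integers"
  obtains r where "0 \<le> r" "r < int CARD('p) ^ m" "x - of_int r \<in> padic_ideal m"
proof -
  let ?q = "int CARD('p) ^ m"
  have q: "?q > 0" using CARD_gt_1[where 'p = 'p] by simp
  have "1 / real CARD('p) ^ m > 0" using CARD_gt_1[where 'p = 'p] by simp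
  then obtain s where s: "padic_norm (x - padic_of_rat s) < 1 / real CARD('p) ^ m"
    by (rule padic_of_rat_dense)
  hence sm: "x - padic_of_rat s \<in> padic_ideal m" by (simp add: padic_ideal_def)
  hence "x - padic_of_rat s \<in> padic_ideal 0" by (rule padic_ideal_mono) simp
  hence "padic_of_rat s \<in> (padic_ideal 0 :: 'p padic set)"
    using padic_ideal_cong assms padic_ideal_0 by blast
  hence "padic_abs CARD('p) s \<le> 1" by (simp add: padic_ideal_def padic_norm_of_rat)
  then obtain z where z: "padic_abs CARD('p) (s - of_int z) \<le> 1 / real CARD('p) ^ m"
    using padic_abs_approx_int[OF prime_card] by blast
  have "(padic_of_rat (s - of_int z) :: 'p padic) \<in> padic_ideal m"
    using z by (simp add: padic_ideal_def padic_norm_of_rat)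
  hence 1: "padic_of_rat s - of_int z \<in> (padic_ideal m :: 'p padic set)"
    by (simp add: padic_of_rat_diff padic_of_rat_of_int)
  have "(of_int (z - z mod ?q) :: 'p padic) \<in> padic_ideal m"
    unfolding of_int_in_padic_ideal_iff by (rule dvd_minus_mod)
  hence 2: "of_int z - of_int (z mod ?q) \<in> (padic_ideal m :: 'p padic set)" by simp
  have "x - of_int (z mod ?q) \<in> padic_ideal m"
    using padic_ideal_add[OF padic_ideal_add[OF sm 1] 2] by simp
  thus ?thesis using that[of "z mod ?q"] q by simp
qed

lemma padic_residue_unique:
  fixes x :: "'p::prime_card padic"
  assumes "0 \<le> r" "r < int CARD('p) ^ m" "x - of_int r \<in> padic_ideal m"
    and "0 \<le> s" "s < int CARD('p) ^ m" "x - of_int s \<in> padic_ideal m"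
  shows "r = s"
proof -
  have "of_int (s - r) \<in> (padic_ideal m :: 'p padic set)"
    using padic_ideal_diff[OF assms(3) assms(6)] by simp
  hence "int CARD('p) ^ m dvd s - r" by (simp only: of_int_in_padic_ideal_iff)
  hence "s mod int CARD('p) ^ m = r mod int CARD('p) ^ m" by (simp add: mod_eq_dvd_iff)
  thus ?thesis using assms by simp
qed

definition padic_residue :: "nat \<Rightarrow> 'p::prime_card padic \<Rightarrow> int" where
  "padic_residue m x = (THE r. 0 \<le> r \<and> r < int CARD('p) ^ m \<and> x - of_int r \<in> padic_ideal m)"

lemma padic_residue_eqI:
  fixes x :: "'p::prime_card padic"
  assumes "0 \<le> r" "r < int CARD('p) ^ m" "x - of_int r \<in> padic_ideal m"
  shows "padic_residue m x = r"
  unfolding padic_residue_def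
  by (rule the_equality) (use assms padic_residue_unique[where 'p = 'p] in blast)+

lemma padic_residue:
  fixes x :: "'p::prime_card padic"
  assumes "x \<in> padic_integers"
  shows "0 \<le> padic_residue m x" "padic_residue m x < int CARD('p) ^ m"
    "x - of_int (padic_residue m x) \<in> padic_ideal m"
proof -
  obtain r where r: "0 \<le> r" "r < int CARD('p) ^ m" "x - of_int r \<in> padic_ideal m"
    using padic_residue_exists[OF assms] by blast
  thus "0 \<le> padic_residue m x" "padic_residue m x < int CARD('p) ^ m"
    "x - of_int (padic_residue m x) \<in> padic_ideal m"
    using padic_residue_eqI[OF r] by simp_all
qed

text \<open>
  No norm lies strictly between two consecutive powers of p, because x may be replaced by an integer
  so close to it that the norm does not change.
\<close>

lemma padic_norm_eqI:
  fixes x :: "'p::prime_card padic"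
  assumes "x \<in> padic_ideal j" "x \<notin> padic_ideal (Suc j)"
  shows "padic_norm x = 1 / real CARD('p) ^ j"
proof -
  obtain r where "x - of_int r \<in> padic_ideal (Suc j)"
    using padic_residue_exists[OF padic_ideal_subset_integers[OF assms(1)]] by blast
  note r = this padic_ideal_mono[OF this, of j]
  have j: "int CARD('p) ^ j dvd r" and Sj: "\<not> int CARD('p) ^ Suc j dvd r"
    using padic_ideal_cong[OF r(1)] padic_ideal_cong[OF r(2)] assms
    by (simp_all add: of_int_in_padic_ideal_iff)
  have "multiplicity (int CARD('p)) r = j"
    using j Sj by (intro multiplicity_eqI)
  moreover have "r \<noteq> 0" using Sj by auto
  ultimately have rn: "padic_norm (of_int r :: 'p padic) = 1 / real CARD('p) ^ j"
    by (simp add: padic_norm_of_int padic_abs_of_int[OF prime_card])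
  have "1 / real CARD('p) ^ Suc j < 1 / real CARD('p) ^ j"
    using CARD_gt_1[where 'p = 'p] by (intro divide_strict_left_mono power_strict_increasing) auto
  hence "padic_norm (of_int r - x) < padic_norm (of_int r :: 'p padic)"
    using r(1) rn padic_norm_minus_commute[of x "of_int r"] by (simp add: padic_ideal_def)
  moreover have "padic_norm (of_int r :: 'p padic) \<le> max (padic_norm x) (padic_norm (of_int r - x))"
    using padic_norm_ultra[of x "of_int r - x"] by simp
  ultimately have "padic_norm (of_int r :: 'p padic) \<le> padic_norm x" by linarith
  thus ?thesis using assms(1) rn by (simp add: padic_ideal_def)
qed


section \<open>Compactness of the ring of p-adic integers\<close>

lemma cball_eq_padic_coset:
  "cball (a :: 'p::prime_card padic) (1 / real CARD('p) ^ k) = {x. x - a \<in> padic_ideal k}"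
  by (auto simp: dist_padic_def padic_ideal_def padic_norm_minus_commute)

lemma padic_integers_eq_cball: "padic_integers = cball 0 1"
  by (auto simp: padic_integers_def dist_padic_def padic_norm_minus)

lemma complete_padic_integers: "Topological_Spaces.complete (padic_integers :: 'p::prime_card padic set)"
  unfolding metric_space_class.complete_def
proof (intro allI impI)
  fix f :: "nat \<Rightarrow> 'p padic"
  assume f: "(\<forall>n. f n \<in> padic_integers) \<and> Cauchy f"
  have "\<exists>r. padic_norm (f n - padic_of_rat r) < 1 / real (Suc n)" for n
    using padic_of_rat_dense[of "1 / real (Suc n)" "f n"] by auto
  then obtain r where r: "\<And>n. padic_norm (f n - padic_of_rat (r n)) < 1 / real (Suc n)"
    by metis
  have inv: "(\<lambda>n. 1 / real (Suc n)) \<longlonglongrightarrow> 0"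
    using LIMSEQ_inverse_real_of_nat by (simp add: inverse_eq_divide)
  have "padic_cauchy CARD('p) r"
    unfolding padic_cauchy_def
  proof (intro allI impI)
    fix e :: real assume e: "e > 0"
    obtain M where M: "\<And>m n. m \<ge> M \<Longrightarrow> n \<ge> M \<Longrightarrow> dist (f m) (f n) < e"
      using f e unfolding Cauchy_def by blast
    obtain N where N: "\<And>n. n \<ge> N \<Longrightarrow> 1 / real (Suc n) < e"
      using order_tendstoD(2)[OF inv e] unfolding eventually_sequentially by blast
    have "padic_abs CARD('p) (r m - r n) < e" if "m \<ge> max M N" "n \<ge> max M N" for m n
    proof -
      have "padic_norm (f m - f n) < e" using M that by (simp add: dist_padic_def)
      moreover have "padic_norm (padic_of_rat (r m) - f m) < e"
        using r[of m] N[of m] that padic_norm_minus_commute[of "f m"] by simp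
      moreover have "padic_norm (f n - padic_of_rat (r n)) < e" using r[of n] N[of n] that by simp
      moreover have "(padic_of_rat (r m - r n) :: 'p padic) =
          (padic_of_rat (r m) - f m) + ((f m - f n) + (f n - padic_of_rat (r n)))"
        by (simp add: padic_of_rat_diff)
      ultimately have "padic_norm (padic_of_rat (r m - r n) :: 'p padic) < e"
        using padic_norm_ultra[of "padic_of_rat (r m) - f m" "(f m - f n) + (f n - padic_of_rat (r n))"]
          padic_norm_ultra[of "f m - f n" "f n - padic_of_rat (r n)"] by simp
      thus ?thesis by (simp add: padic_norm_of_rat)
    qed
    thus "\<exists>N. \<forall>m\<ge>N. \<forall>n\<ge>N. padic_abs CARD('p) (r m - r n) < e" by blast
  qed
  then obtain x :: "'p padic" where x: "(\<lambda>n. padic_norm (x - padic_of_rat (r n))) \<longlonglongrightarrow> 0"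
    by (rule padic_cauchy_limit)
  have lim: "f \<longlonglongrightarrow> x"
  proof (rule metric_tendsto_imp_tendsto[OF tendsto_add_zero[OF inv x], of f x])
    show "\<forall>\<^sub>F n in sequentially. dist (f n) x \<le>
        dist (1 / real (Suc n) + padic_norm (x - padic_of_rat (r n))) 0"
    proof (intro always_eventually allI)
      fix n
      have "dist (f n) x = padic_norm ((f n - padic_of_rat (r n)) + (padic_of_rat (r n) - x))"
        by (simp add: dist_padic_def)
      also have "\<dots> \<le> padic_norm (f n - padic_of_rat (r n)) + padic_norm (padic_of_rat (r n) - x)"
        by (rule padic_norm_triangle)
      finally show "dist (f n) x \<le> dist (1 / real (Suc n) + padic_norm (x - padic_of_rat (r n))) 0"
        using r[of n] padic_norm_minus_commute[of x "padic_of_rat (r n)"]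
        by (simp add: dist_real_def)
    qed
  qed
  have "closed (padic_integers :: 'p padic set)" by (simp add: padic_integers_eq_cball)
  hence "x \<in> padic_integers" using f lim by (metis closed_sequentially)
  thus "\<exists>l\<in>padic_integers. f \<longlonglongrightarrow> l" using lim by blast
qed

lemma compact_padic_integers: "compact (padic_integers :: 'p::prime_card padic set)"
  unfolding compact_eq_totally_bounded
proof (intro conjI complete_padic_integers allI impI)
  fix e :: real assume "e > 0"
  then obtain m where m: "1 / real CARD('p) ^ m < e" by (rule inverse_power_less)
  have "padic_integers \<subseteq> (\<Union>x\<in>of_int ` {0..<int CARD('p) ^ m}. ball (x :: 'p padic) e)"
  proof
    fix x :: "'p padic" assume x: "x \<in> padic_integers"
    have "dist (of_int (padic_residue m x)) x < e"
      using padic_residue(3)[OF x, of m] m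
      by (simp add: dist_padic_def padic_ideal_def padic_norm_minus_commute)
    thus "x \<in> (\<Union>x\<in>of_int ` {0..<int CARD('p) ^ m}. ball (x :: 'p padic) e)"
      using padic_residue(1,2)[OF x, of m] by auto
  qed
  thus "\<exists>k. finite k \<and> padic_integers \<subseteq> (\<Union>x\<in>k. ball (x :: 'p padic) e)" by blast
qed

lemma padic_coset_subset_integers:
  "a \<in> padic_integers \<Longrightarrow> x - a \<in> padic_ideal k \<Longrightarrow> x \<in> padic_integers"
  using padic_integers_add[OF padic_ideal_subset_integers[of "x - a" k], of a] by simp

lemma compact_padic_coset:
  assumes "(a :: 'p::prime_card padic) \<in> padic_integers"
  shows "compact {x. x - a \<in> padic_ideal k}"
proof -
  have "padic_integers \<inter> {x. x - a \<in> padic_ideal k} = {x. x - a \<in> padic_ideal k}"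
    using padic_coset_subset_integers[OF assms] by blast
  moreover have "closed {x. x - a \<in> padic_ideal k}" by (simp flip: cball_eq_padic_coset)
  ultimately show ?thesis using compact_Int_closed[OF compact_padic_integers] by metis
qed


section \<open>Polynomials with p-adic integer coefficients\<close>

definition integral_poly :: "'p::prime_card padic poly \<Rightarrow> bool" where
  "integral_poly f \<longleftrightarrow> (\<forall>i. Polynomial.coeff f i \<in> padic_integers)"

lemma integral_poly_pCons_iff:
  "integral_poly (pCons c f) \<longleftrightarrow> c \<in> padic_integers \<and> integral_poly f"
  unfolding integral_poly_def by (metis coeff_pCons_0 coeff_pCons_Suc not0_implies_Suc)

lemma integral_poly_pderiv: "integral_poly f \<Longrightarrow> integral_poly (pderiv f)"
  using padic_integers_mult[OF of_int_in_padic_integers[of "int m" for m]]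
  by (auto simp: integral_poly_def coeff_pderiv simp del: of_nat_Suc)

lemma poly_in_padic_integers:
  "integral_poly f \<Longrightarrow> x \<in> padic_integers \<Longrightarrow> poly f x \<in> padic_integers"
  by (induction f) (auto simp: integral_poly_pCons_iff intro!: padic_integers_add padic_integers_mult)

text \<open>
  The remainder of Taylor's formula of first order is again divisible by the square of the increment,
  with a quotient that is a p-adic integer; no division by 2 occurs.
\<close>

lemma taylor_integral_poly:
  assumes "integral_poly f" "x \<in> padic_integers" "h \<in> padic_integers"
  obtains e where "e \<in> padic_integers"
    "poly f (x + h) = poly f x + h * poly (pderiv f) x + h ^ 2 * e"
  using assms(1)
proof (induction f arbitrary: thesis)
  case 0
  show ?case by (rule "0"(1)[of 0]) auto
next
  case (pCons c f)
  have f: "integral_poly f" using pCons.prems(2) by (simp add: integral_poly_pCons_iff)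
  then obtain e where e: "e \<in> padic_integers"
    "poly f (x + h) = poly f x + h * poly (pderiv f) x + h ^ 2 * e"
    using pCons.IH by blast
  define e' where "e' = poly (pderiv f) x + x * e + h * e"
  have e'Z: "e' \<in> padic_integers" unfolding e'_def
    by (intro padic_integers_add padic_integers_mult poly_in_padic_integers integral_poly_pderiv
        f e(1) assms(2,3))
  have "poly (pCons c f) (x + h) = c + (x + h) * (poly f x + h * poly (pderiv f) x + h ^ 2 * e)"
    by (simp only: poly_pCons e(2))
  also have "\<dots> = poly (pCons c f) x + h * poly (pderiv (pCons c f)) x + h ^ 2 * e'"
    by (simp add: e'_def pderiv_pCons algebra_simps power2_eq_square)
  finally show ?case by (rule pCons.prems(1)[OF e'Z])
qed

lemma poly_cong_padic_ideal:
  assumes "integral_poly f" "y \<in> padic_integers" "x - y \<in> padic_ideal k"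
  shows "poly f x - poly f y \<in> padic_ideal k"
proof -
  have h: "x - y \<in> padic_integers" using assms(3) by (rule padic_ideal_subset_integers)
  obtain e where e: "e \<in> padic_integers"
    "poly f (y + (x - y)) = poly f y + (x - y) * poly (pderiv f) y + (x - y) ^ 2 * e"
    using taylor_integral_poly[OF assms(1,2) h] by blast
  have "poly f x - poly f y = (poly (pderiv f) y + (x - y) * e) * (x - y)"
    using e(2) by (simp add: algebra_simps power2_eq_square)
  moreover have "poly (pderiv f) y + (x - y) * e \<in> padic_integers"
    by (intro padic_integers_add padic_integers_mult poly_in_padic_integers integral_poly_pderiv
        assms e(1) h)
  ultimately show ?thesis using padic_ideal_mult_integer[OF _ assms(3)] by metis
qed

text \<open>Existence of roots is obtained from this minimum, which takes the place of a limit of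
  successive approximations.\<close>

lemma padic_norm_poly_attains_min:
  fixes f :: "'p::prime_card padic poly"
  assumes "integral_poly f" "a \<in> padic_integers"
  obtains x where "x - a \<in> padic_ideal k"
    "\<And>y. y - a \<in> padic_ideal k \<Longrightarrow> padic_norm (poly f x) \<le> padic_norm (poly f y)"
proof -
  let ?S = "{x. x - a \<in> padic_ideal k}"
  have "continuous_on ?S (\<lambda>x. padic_norm (poly f x))"
    unfolding continuous_on_iff
  proof (intro ballI allI impI)
    fix x e assume x: "x \<in> ?S" and e: "(e :: real) > 0"
    then obtain m where m: "1 / real CARD('p) ^ m < e" using inverse_power_less by blast
    have "dist (padic_norm (poly f y)) (padic_norm (poly f x)) < e"
      if y: "y \<in> ?S" "dist y x < 1 / real CARD('p) ^ m" for y
    proof -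
      have "y - x \<in> padic_ideal m" using y(2) by (simp add: dist_padic_def padic_ideal_def)
      hence "poly f y - poly f x \<in> padic_ideal m"
        using x assms padic_coset_subset_integers poly_cong_padic_ideal by blast
      thus ?thesis
        using m padic_norm_diff_ineq[of "poly f y" "poly f x"]
        by (simp add: padic_ideal_def dist_real_def)
    qed
    moreover have "1 / real CARD('p) ^ m > 0" using CARD_gt_1[where 'p = 'p] by simp
    ultimately show "\<exists>d>0. \<forall>y\<in>?S. dist y x < d \<longrightarrow> dist (padic_norm (poly f y)) (padic_norm (poly f x)) < e"
      by blast
  qed
  moreover have "a \<in> ?S" by simp
  hence "?S \<noteq> {}" by blast
  ultimately obtain x where "x \<in> ?S" "\<And>y. y \<in> ?S \<Longrightarrow> padic_norm (poly f x) \<le> padic_norm (poly f y)"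
    using continuous_attains_inf[OF compact_padic_coset[OF assms(2)]] by metis
  thus ?thesis using that by blast
qed

definition has_root_in_coset :: "'p::prime_card padic poly \<Rightarrow> 'p padic \<Rightarrow> nat \<Rightarrow> bool" where
  "has_root_in_coset f a k \<longleftrightarrow> (\<exists>x. x - a \<in> padic_ideal k \<and> poly f x = 0)"

text \<open>
  Only countable quantifiers occur on the right, which is what makes the existence of a root an event
  for a random polynomial. By compactness, arbitrarily small values on the coset force a zero.
\<close>

lemma has_root_in_coset_iff_approx:
  fixes f :: "'p::prime_card padic poly"
  assumes "integral_poly f" "a \<in> padic_integers"
  shows "has_root_in_coset f a k \<longleftrightarrow>
    (\<forall>m. \<exists>b. of_int b - a \<in> padic_ideal k \<and> poly f (of_int b) \<in> padic_ideal m)"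
proof (intro iffI allI)
  fix m
  assume "has_root_in_coset f a k"
  then obtain x where x: "x - a \<in> padic_ideal k" "poly f x = 0"
    unfolding has_root_in_coset_def by blast
  have xZ: "x \<in> padic_integers" using padic_coset_subset_integers[OF assms(2) x(1)] .
  obtain b where "x - of_int b \<in> padic_ideal (max k m)" using padic_residue_exists[OF xZ] by blast
  hence b: "of_int b - x \<in> padic_ideal (max k m)" by (simp only: padic_ideal_diff_commute)
  have "of_int b - a = (of_int b - x) + (x - a)" by simp
  hence 1: "of_int b - a \<in> padic_ideal k"
    using padic_ideal_add[OF padic_ideal_mono[OF b max.cobounded1] x(1)] by simp
  have 2: "poly f (of_int b) \<in> padic_ideal m"
    using poly_cong_padic_ideal[OF assms(1) xZ padic_ideal_mono[OF b max.cobounded2]] x(2) by simp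
  show "\<exists>b. of_int b - a \<in> padic_ideal k \<and> poly f (of_int b) \<in> padic_ideal m"
    using 1 2 by blast
next
  assume R: "\<forall>m. \<exists>b. of_int b - a \<in> padic_ideal k \<and> poly f (of_int b) \<in> padic_ideal m"
  obtain x where x: "x - a \<in> padic_ideal k"
    "\<And>y. y - a \<in> padic_ideal k \<Longrightarrow> padic_norm (poly f x) \<le> padic_norm (poly f y)"
    using padic_norm_poly_attains_min[OF assms] by blast
  have "poly f x \<in> padic_ideal m" for m
    using R x(2) unfolding padic_ideal_def by (metis (mono_tags, lifting) mem_Collect_eq order_trans)
  hence "poly f x = 0" by (rule eq_0_if_in_all_padic_ideals)
  thus "has_root_in_coset f a k" using x(1) unfolding has_root_in_coset_def by blast
qed

lemma value_at_centre_of_root_coset: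
  assumes "integral_poly f" "a \<in> padic_integers" "poly (pderiv f) a \<in> padic_ideal j" "j \<le> k"
    and "has_root_in_coset f a k"
  shows "poly f a \<in> padic_ideal (k + j)"
proof -
  obtain x where x: "x - a \<in> padic_ideal k" "poly f x = 0"
    using assms(5) unfolding has_root_in_coset_def by blast
  obtain e where e: "e \<in> padic_integers"
    "poly f (a + (x - a)) = poly f a + (x - a) * poly (pderiv f) a + (x - a) ^ 2 * e"
    using taylor_integral_poly[OF assms(1,2) padic_ideal_subset_integers[OF x(1)]] by blast
  have "(x - a) * poly (pderiv f) a \<in> padic_ideal (k + j)"
    using padic_ideal_mult[OF x(1) assms(3)] .
  moreover have "e * ((x - a) * (x - a)) \<in> padic_ideal (k + k)"
    by (intro padic_ideal_mult_integer padic_ideal_mult e(1) x(1))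
  hence "e * ((x - a) * (x - a)) \<in> padic_ideal (k + j)"
    by (rule padic_ideal_mono) (use assms(4) in simp)
  ultimately have "- ((x - a) * poly (pderiv f) a + e * ((x - a) * (x - a))) \<in> padic_ideal (k + j)"
    by (intro padic_ideal_uminus padic_ideal_add)
  moreover have "poly f a = - ((x - a) * poly (pderiv f) a + e * ((x - a) * (x - a)))"
    using e(2) x(2) by (simp add: power2_eq_square algebra_simps)
  ultimately show ?thesis by simp
qed

text \<open>
  Hensel's lemma. If the minimum of the norm of f on the coset were positive, a Newton step from a
  minimising point would stay in the coset and make the norm strictly smaller.
\<close>

lemma hensel_coset:
  fixes f :: "'p::prime_card padic poly"
  assumes f: "integral_poly f" and a: "a \<in> padic_integers" and jk: "j < k"
    and deriv: "poly (pderiv f) a \<in> padic_ideal j" "poly (pderiv f) a \<notin> padic_ideal (Suc j)"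
    and val: "poly f a \<in> padic_ideal (k + j)"
  shows "has_root_in_coset f a k"
proof -
  let ?p = "real CARD('p)"
  have p1: "?p > 1" by (rule CARD_gt_1)
  obtain x where x: "x - a \<in> padic_ideal k"
    "\<And>y. y - a \<in> padic_ideal k \<Longrightarrow> padic_norm (poly f x) \<le> padic_norm (poly f y)"
    using padic_norm_poly_attains_min[OF f a] by blast
  have xZ: "x \<in> padic_integers" using padic_coset_subset_integers[OF a x(1)] .
  have xval: "padic_norm (poly f x) \<le> 1 / ?p ^ (k + j)"
    using x(2)[of a] val by (simp add: padic_ideal_def)
  have "poly (pderiv f) x - poly (pderiv f) a \<in> padic_ideal (Suc j)"
    using poly_cong_padic_ideal[OF integral_poly_pderiv[OF f] a x(1)] padic_ideal_mono jk
    by (metis Suc_leI)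
  note dcong = this padic_ideal_mono[OF this, of j]
  have D: "padic_norm (poly (pderiv f) x) = 1 / ?p ^ j"
    using padic_ideal_cong[OF dcong(1)] padic_ideal_cong[OF dcong(2)] deriv
    by (intro padic_norm_eqI) auto
  (* The Newton step from x: it cancels the linear part of the Taylor expansion. *)
  define h where "h = - poly f x / poly (pderiv f) x"
  have hn: "padic_norm h = padic_norm (poly f x) * ?p ^ j"
    by (simp add: h_def padic_norm_divide padic_norm_minus D)
  also have "\<dots> \<le> 1 / ?p ^ (k + j) * ?p ^ j"
    using xval p1 by (intro mult_right_mono) auto
  also have "\<dots> = 1 / ?p ^ k" using p1 by (simp add: power_add)
  finally have h: "h \<in> padic_ideal k" by (simp add: padic_ideal_def)
  obtain e where e: "e \<in> padic_integers"
    "poly f (x + h) = poly f x + h * poly (pderiv f) x + h ^ 2 * e"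
    using taylor_integral_poly[OF f xZ padic_ideal_subset_integers[OF h]] by blast
  have "poly (pderiv f) x \<noteq> 0" using D p1 by auto
  hence y: "poly f (x + h) = h ^ 2 * e" using e(2) by (simp add: h_def)
  have "x + h - a \<in> padic_ideal k" using padic_ideal_add[OF x(1) h] by (simp add: algebra_simps)
  hence "padic_norm (poly f x) \<le> padic_norm (poly f (x + h))" by (rule x(2))
  also have "\<dots> \<le> padic_norm h ^ 2"
    using e(1) mult_left_mono[of "padic_norm e" 1 "padic_norm h ^ 2"]
    by (simp add: y padic_norm_mult padic_norm_power padic_integers_def)
  also have "\<dots> = padic_norm (poly f x) * (padic_norm (poly f x) * ?p ^ (j + j))"
    by (simp add: hn power2_eq_square power_add)
  finally have le: "padic_norm (poly f x) * 1 \<le>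
      padic_norm (poly f x) * (padic_norm (poly f x) * ?p ^ (j + j))" by simp
  have "padic_norm (poly f x) * ?p ^ (j + j) \<le> 1 / ?p ^ (k + j) * ?p ^ (j + j)"
    using xval p1 by (intro mult_right_mono) auto
  also have "\<dots> = ?p ^ j / ?p ^ k" using p1 by (simp add: power_add)
  also have "\<dots> < 1" using p1 jk by (simp add: power_strict_increasing)
  finally have lt: "padic_norm (poly f x) * ?p ^ (j + j) < 1" .
  have "\<not> padic_norm (poly f x) > 0"
    using le lt mult_strict_left_mono[OF lt, of "padic_norm (poly f x)"] by linarith
  hence "poly f x = 0" using padic_norm_nonneg[of "poly f x"] padic_norm_eq_0_iff by force
  thus ?thesis using x(1) unfolding has_root_in_coset_def by blast
qed


section \<open>Counting roots by cosets\<close>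

lemma padic_norm_sum_le:
  assumes "\<And>i. i \<in> A \<Longrightarrow> padic_norm (g i) \<le> B" "B \<ge> 0"
  shows "padic_norm (\<Sum>i\<in>A. g i) \<le> B"
  using assms(1)
proof (induction A rule: infinite_finite_induct)
  case (insert i A)
  thus ?case using padic_norm_ultra[of "g i" "sum g A"] by fastforce
qed (use assms(2) in auto)

text \<open>
  At a point of norm greater than 1 the leading term strictly dominates all the others.
\<close>

lemma integral_monic_root_integral:
  fixes f :: "'p::prime_card padic poly"
  assumes "integral_poly f" "monic f" "poly f x = 0"
  shows "x \<in> padic_integers"
proof (rule ccontr)
  assume "x \<notin> padic_integers"
  hence x1: "padic_norm x > 1" by (simp add: padic_integers_def)
  have "poly f x = (\<Sum>i<degree f. Polynomial.coeff f i * x ^ i) + x ^ degree f"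
    using assms(2) by (simp add: poly_altdef lessThan_Suc_atMost[symmetric])
  hence eq: "x ^ degree f = - (\<Sum>i<degree f. Polynomial.coeff f i * x ^ i)"
    using assms(3) by (simp add: eq_neg_iff_add_eq_0 add.commute)
  have "degree f \<noteq> 0"
    using eq by (intro notI) simp
  then obtain d where d: "degree f = Suc d" by (cases "degree f") auto
  have "padic_norm (Polynomial.coeff f i * x ^ i) \<le> padic_norm x ^ d" if "i < Suc d" for i
  proof -
    have "padic_norm (Polynomial.coeff f i) * padic_norm x ^ i \<le> 1 * padic_norm x ^ d"
      using assms(1) x1 that
      by (intro mult_mono power_increasing) (auto simp: integral_poly_def padic_integers_def)
    thus ?thesis by (simp add: padic_norm_mult padic_norm_power)
  qed
  hence "padic_norm (- (\<Sum>i<degree f. Polynomial.coeff f i * x ^ i)) \<le> padic_norm x ^ d"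
    unfolding padic_norm_minus d by (intro padic_norm_sum_le) auto
  hence "padic_norm (x ^ degree f) \<le> padic_norm x ^ d"
    by (simp only: eq)
  hence "padic_norm x ^ Suc d \<le> padic_norm x ^ d" by (simp only: padic_norm_power d)
  thus False using x1 power_strict_increasing[of d "Suc d" "padic_norm x"] by simp
qed

definition root_cosets :: "'p::prime_card padic poly \<Rightarrow> nat \<Rightarrow> int set" where
  "root_cosets f k = {a \<in> {0..<int CARD('p) ^ k}. has_root_in_coset f (of_int a) k}"

lemma root_cosets_eq_image:
  fixes f :: "'p::prime_card padic poly"
  assumes "integral_poly f" "monic f"
  shows "root_cosets f k = padic_residue k ` {x. poly f x = 0}"
proof (intro equalityI subsetI)
  fix a assume "a \<in> root_cosets f k"
  then obtain x where "0 \<le> a" "a < int CARD('p) ^ k" "x - of_int a \<in> padic_ideal k" "poly f x = 0"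
    by (auto simp: root_cosets_def has_root_in_coset_def)
  moreover from this have "padic_residue k x = a" by (intro padic_residue_eqI)
  ultimately show "a \<in> padic_residue k ` {x. poly f x = 0}" by blast
next
  fix a assume "a \<in> padic_residue k ` {x. poly f x = 0}"
  then obtain x where x: "poly f x = 0" "a = padic_residue k x" by blast
  show "a \<in> root_cosets f k"
    using padic_residue[OF integral_monic_root_integral[OF assms x(1)], of k] x
    by (auto simp: root_cosets_def has_root_in_coset_def)
qed

lemma card_root_cosets_le:
  fixes f :: "'p::prime_card padic poly"
  assumes "integral_poly f" "monic f"
  shows "card (root_cosets f k) \<le> degree f"
proof -
  have f0: "f \<noteq> 0" using assms(2) by auto
  have "card (root_cosets f k) \<le> card {x. poly f x = 0}"
    unfolding root_cosets_eq_image[OF assms] by (intro card_image_le poly_roots_finite f0)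
  also have "\<dots> \<le> degree f" by (rule poly_roots_degree[OF f0])
  finally show ?thesis .
qed

lemma eventually_card_root_cosets:
  fixes f :: "'p::prime_card padic poly"
  assumes "integral_poly f" "monic f"
  shows "\<forall>\<^sub>F k in sequentially. card (root_cosets f k) = root_count f"
proof -
  let ?R = "{x. poly f x = 0}"
  have fin: "finite ?R" using assms(2) by (intro poly_roots_finite) auto
  have "\<forall>\<^sub>F k in sequentially. x \<noteq> y \<longrightarrow> x - y \<notin> padic_ideal k" for x y :: "'p padic"
  proof (cases "x = y")
    case False
    then obtain m where "x - y \<notin> padic_ideal m"
      using eq_0_if_in_all_padic_ideals[of "x - y"] by auto
    hence "x - y \<notin> padic_ideal k" if "k \<ge> m" for k using padic_ideal_mono that by blast
    thus ?thesis unfolding eventually_sequentially by blast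
  qed simp
  hence "\<forall>\<^sub>F k in sequentially. \<forall>x\<in>?R. \<forall>y\<in>?R. x \<noteq> y \<longrightarrow> x - y \<notin> padic_ideal k"
    by (intro eventually_ball_finite fin ballI)
  thus ?thesis
  proof eventually_elim
    case (elim k)
    have "inj_on (padic_residue k) ?R"
    proof (rule inj_onI)
      fix x y assume xy: "x \<in> ?R" "y \<in> ?R" "padic_residue k x = padic_residue k y"
      have Z: "x \<in> padic_integers" "y \<in> padic_integers"
        using xy integral_monic_root_integral[OF assms] by auto
      have "x - y \<in> padic_ideal k"
        using padic_ideal_diff[OF padic_residue(3)[OF Z(1)] padic_residue(3)[OF Z(2)], of k] xy(3)
        by simp
      thus "x = y" using elim xy by blast
    qed
    thus ?case unfolding root_count_def root_cosets_eq_image[OF assms] by (rule card_image)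
  qed
qed


section \<open>Haar measure of cosets\<close>

lemma padic_coset_borel [measurable]: "{x. x - a \<in> padic_ideal k} \<in> sets borel"
  by (simp flip: cball_eq_padic_coset)

lemma padic_integers_borel [measurable]: "padic_integers \<in> sets borel"
  by (simp add: padic_integers_eq_cball)

text \<open>The translates of \<^term>\<open>padic_ideal m\<close> by the residues partition the unit ball
  into sets of equal measure.\<close>

lemma emeasure_padic_coset:
  fixes \<mu> :: "'p::prime_card padic measure"
  assumes "padic_haar_measure \<mu>"
  shows "emeasure \<mu> {x. x - a \<in> padic_ideal m} = ennreal (1 / real CARD('p) ^ m)"
proof -
  let ?C = "\<lambda>a. {x :: 'p padic. x - a \<in> padic_ideal m}"
  let ?N = "{0..<int CARD('p) ^ m}"
  have sets: "sets \<mu> = sets borel"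
    using assms by (simp add: padic_haar_measure_def regular_borel_measure_def)
  have transl: "emeasure \<mu> (?C a) = emeasure \<mu> (?C 0)" for a
  proof -
    have "?C a = (+) a ` ?C 0"
    proof (intro equalityI subsetI)
      fix x assume "x \<in> ?C a"
      hence "x = a + (x - a)" "x - a \<in> ?C 0" by simp_all
      thus "x \<in> (+) a ` ?C 0" by (rule image_eqI)
    qed auto
    thus ?thesis using assms padic_coset_borel[of 0 m] unfolding padic_haar_measure_def by metis
  qed
  have disj: "disjoint_family_on (\<lambda>r. ?C (of_int r)) ?N"
  proof (unfold disjoint_family_on_def, intro ballI impI)
    fix r s assume rs: "r \<in> ?N" "s \<in> ?N" "r \<noteq> s"
    have "r = s" if "x - of_int r \<in> padic_ideal m" "x - of_int s \<in> padic_ideal m" for x :: "'p padic"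
      using rs that by (intro padic_residue_unique[of r m x s]) auto
    with rs(3) show "?C (of_int r) \<inter> ?C (of_int s) = {}" by blast
  qed
  have "padic_integers = (\<Union>r\<in>?N. ?C (of_int r))"
  proof (intro equalityI subsetI)
    fix x :: "'p padic" assume "x \<in> padic_integers"
    then obtain r where "0 \<le> r" "r < int CARD('p) ^ m" "x - of_int r \<in> padic_ideal m"
      using padic_residue_exists by blast
    thus "x \<in> (\<Union>r\<in>?N. ?C (of_int r))" by (intro UN_I[of r]) auto
  qed (use padic_coset_subset_integers[OF of_int_in_padic_integers] in blast)
  hence "1 = emeasure \<mu> (\<Union>r\<in>?N. ?C (of_int r))"
    using assms by (simp add: padic_haar_measure_def)
  also have "\<dots> = (\<Sum>r\<in>?N. emeasure \<mu> (?C (of_int r)))"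
  proof (rule sum_emeasure[symmetric, OF _ disj])
    show "(\<lambda>r. ?C (of_int r)) ` ?N \<subseteq> sets \<mu>"
      unfolding sets using padic_coset_borel by blast
  qed simp
  also have "\<dots> = ennreal (real CARD('p) ^ m) * emeasure \<mu> (?C 0)"
    unfolding transl[of "of_int r" for r]
    by (simp add: nat_power_eq ennreal_of_nat_eq_real_of_nat)
  finally have eq: "ennreal (real CARD('p) ^ m) * emeasure \<mu> (?C 0) = 1" ..
  have pos: "real CARD('p) ^ m > 0" using CARD_gt_1[where 'p = 'p] by simp
  have "emeasure \<mu> (?C 0) = (ennreal (1 / real CARD('p) ^ m) * ennreal (real CARD('p) ^ m)) * emeasure \<mu> (?C 0)"
    using pos by (simp flip: ennreal_mult)
  also have "\<dots> = ennreal (1 / real CARD('p) ^ m)"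
    unfolding mult.assoc eq by simp
  finally show ?thesis using transl by simp
qed

text \<open>
  Through the residues all events that concern finitely many values of the random polynomial become
  events of discrete random variables, so that the Borel structure of products of the p-adic numbers
  never enters.
\<close>

lemma measurable_padic_residue:
  "padic_residue m \<in> measurable (restrict_space borel (padic_integers :: 'p::prime_card padic set)) (count_space UNIV)"
  unfolding measurable_count_space_eq2_countable
proof (intro conjI ballI)
  fix r :: int
  let ?Z = "padic_integers :: 'p padic set"
  have "padic_residue m -` {r} \<inter> ?Z =
      (if 0 \<le> r \<and> r < int CARD('p) ^ m then {x. x - of_int r \<in> padic_ideal m} else {})"
    using padic_residue[where 'p = 'p and m = m] padic_residue_eqI[where 'p = 'p and m = m and r = r]
      padic_coset_subset_integers[OF of_int_in_padic_integers[where 'a = 'p and z = r], of _ m]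
    by auto
  hence "padic_residue m -` {r} \<inter> ?Z \<in> sets borel" by simp
  thus "padic_residue m -` {r} \<inter> space (restrict_space borel ?Z) \<in> sets (restrict_space borel ?Z)"
    by (simp add: sets_restrict_space_iff space_restrict_space)
qed auto


section \<open>Uniform residues\<close>

text \<open>Conditioning on the class of \<^term>\<open>h (Y \<omega>)\<close> modulo q turns the shift into a constant.\<close>

lemma (in prob_space) prob_dvd_add_indep:
  fixes k h :: "'b \<Rightarrow> int"
  assumes indep: "indep_var (count_space T) X (count_space S) Y" and q: "q > 0"
    and unif: "\<And>c. prob {\<omega> \<in> space M. q dvd k (X \<omega>) + c} = u"
  shows "prob {\<omega> \<in> space M. q dvd k (X \<omega>) + h (Y \<omega>) \<and> Q (Y \<omega>)} = u * prob {\<omega> \<in> space M. Q (Y \<omega>)}"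
proof -
  let ?E = "\<lambda>r. {\<omega> \<in> space M. Q (Y \<omega>) \<and> h (Y \<omega>) mod q = r}"
  let ?F = "\<lambda>r. {\<omega> \<in> space M. q dvd k (X \<omega>) + r}"
  have X: "random_variable (count_space T) X" and Y: "random_variable (count_space S) Y"
    using indep_var_rv1[OF indep] indep_var_rv2[OF indep] .
  have XT: "\<omega> \<in> space M \<Longrightarrow> X \<omega> \<in> T" for \<omega> using measurable_space[OF X] by simp
  have YS: "\<omega> \<in> space M \<Longrightarrow> Y \<omega> \<in> S" for \<omega> using measurable_space[OF Y] by simp
  have Eeq: "?E r = Y -` {y \<in> S. Q y \<and> h y mod q = r} \<inter> space M" for r using YS by auto
  have Feq: "?F r = X -` {x \<in> T. q dvd k x + r} \<inter> space M" for r using XT by auto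
  have E: "?E r \<in> events" for r unfolding Eeq by (rule measurable_sets[OF Y]) auto
  have F: "?F r \<in> events" for r unfolding Feq by (rule measurable_sets[OF X]) auto
  have FE: "prob (?F r \<inter> ?E r) = u * prob (?E r)" for r
  proof -
    have "?F r \<inter> ?E r = (\<lambda>\<omega>. (X \<omega>, Y \<omega>)) -`
        ({x \<in> T. q dvd k x + r} \<times> {y \<in> S. Q y \<and> h y mod q = r}) \<inter> space M"
      using XT YS by auto
    also have "prob \<dots> = prob (?F r) * prob (?E r)"
      unfolding Eeq Feq by (rule indep_varD[OF indep]) auto
    finally show ?thesis by (simp add: unif)
  qed
  have "{\<omega> \<in> space M. q dvd k (X \<omega>) + h (Y \<omega>) \<and> Q (Y \<omega>)} = (\<Union>r\<in>{0..<q}. ?F r \<inter> ?E r)"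
    using q by (auto simp: dvd_eq_mod_eq_0 mod_simps)
  also have "prob \<dots> = (\<Sum>r\<in>{0..<q}. prob (?F r \<inter> ?E r))"
    using E F by (intro finite_measure_finite_Union) (auto simp: disjoint_family_on_def)
  also have "\<dots> = u * (\<Sum>r\<in>{0..<q}. prob (?E r))" by (simp add: FE sum_distrib_left)
  also have "(\<Sum>r\<in>{0..<q}. prob (?E r)) = prob (\<Union>r\<in>{0..<q}. ?E r)"
    using E by (intro finite_measure_finite_Union[symmetric]) (auto simp: disjoint_family_on_def)
  also have "(\<Union>r\<in>{0..<q}. ?E r) = {\<omega> \<in> space M. Q (Y \<omega>)}" using q by auto
  finally show ?thesis .
qed

lemma (in prob_space) prob_dvd_add_indep_vars:
  fixes R :: "'i \<Rightarrow> 'a \<Rightarrow> int" and h :: "('i \<Rightarrow> int) \<Rightarrow> int"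
  assumes indep: "indep_vars (\<lambda>_. count_space UNIV) R I" and I: "finite I" "i \<in> I" "B \<subseteq> I - {i}"
    and q: "q > 0" and unif: "\<And>c. prob {\<omega> \<in> space M. q dvd R i \<omega> + c} = u"
  shows "prob {\<omega> \<in> space M. q dvd R i \<omega> + h (\<lambda>j\<in>B. R j \<omega>) \<and> Q (\<lambda>j\<in>B. R j \<omega>)}
    = u * prob {\<omega> \<in> space M. Q (\<lambda>j\<in>B. R j \<omega>)}"
proof -
  have B: "finite B" using I finite_subset by blast
  have "indep_var (PiM {i} (\<lambda>_. count_space UNIV)) (\<lambda>\<omega>. \<lambda>j\<in>{i}. R j \<omega>)
      (PiM B (\<lambda>_. count_space UNIV)) (\<lambda>\<omega>. \<lambda>j\<in>B. R j \<omega>)"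
    using I by (intro indep_var_restrict[OF indep]) auto
  hence "indep_var (count_space (PiE {i} (\<lambda>_. UNIV))) (\<lambda>\<omega>. \<lambda>j\<in>{i}. R j \<omega>)
      (count_space (PiE B (\<lambda>_. UNIV))) (\<lambda>\<omega>. \<lambda>j\<in>B. R j \<omega>)"
    using B by (simp add: count_space_PiM_finite)
  from prob_dvd_add_indep[OF this q, of "\<lambda>g. g i" u h Q] show ?thesis using unif by simp
qed

section \<open>Values and derivatives of the random polynomial\<close>

text \<open>
  All that matters of Haar measure is the mass of the cosets of integers, so that the measure itself
  does not appear in the locale.
\<close>

locale haar_random_poly = prob_space M
  for M :: "'a measure" +
  fixes \<xi> :: "nat \<Rightarrow> 'a \<Rightarrow> 'p::prime_card padic" and n :: nat
  assumes two_le_n: "2 \<le> n"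
    and indep: "indep_vars (\<lambda>_. restrict_space borel padic_integers) \<xi> {..<n}"
    and prob_coset: "\<And>i a m. i < n \<Longrightarrow>
      prob {\<omega> \<in> space M. \<xi> i \<omega> - of_int a \<in> padic_ideal m} = 1 / real CARD('p) ^ m"
begin

lemma coeff_integral: "i < n \<Longrightarrow> \<omega> \<in> space M \<Longrightarrow> \<xi> i \<omega> \<in> padic_integers"
  using indep measurable_space[of "\<xi> i" M "restrict_space borel padic_integers"]
  by (auto simp: indep_vars_def space_restrict_space)

definition rpoly :: "'a \<Rightarrow> 'p padic poly" where
  "rpoly \<omega> = (\<Sum>i<n. Polynomial.monom (\<xi> i \<omega>) i) + Polynomial.monom 1 n"

lemma coeff_rpoly: "Polynomial.coeff (rpoly \<omega>) i = (if i < n then \<xi> i \<omega> else if i = n then 1 else 0)"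
  by (auto simp: rpoly_def coeff_sum coeff_monom sum.delta')

lemma integral_rpoly: "\<omega> \<in> space M \<Longrightarrow> integral_poly (rpoly \<omega>)"
  using coeff_integral by (auto simp: integral_poly_def coeff_rpoly)

lemma degree_rpoly: "degree (rpoly \<omega>) = n"
  by (intro antisym degree_le le_degree) (auto simp: coeff_rpoly)

lemma monic_rpoly: "monic (rpoly \<omega>)"
  by (simp add: degree_rpoly coeff_rpoly)

definition residue_value :: "(nat \<Rightarrow> int) \<Rightarrow> int \<Rightarrow> int" where
  "residue_value r a = (\<Sum>i<n. r i * a ^ i) + a ^ n"

definition residue_deriv :: "(nat \<Rightarrow> int) \<Rightarrow> int \<Rightarrow> int" where
  "residue_deriv r a = (\<Sum>i<n. int i * r i * a ^ (i - 1)) + int n * a ^ (n - 1)"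

definition coeff_residues :: "nat \<Rightarrow> 'a \<Rightarrow> nat \<Rightarrow> int" where
  "coeff_residues m \<omega> = (\<lambda>i\<in>{..<n}. padic_residue m (\<xi> i \<omega>))"

lemma padic_ideal_sum: "(\<And>i. i \<in> A \<Longrightarrow> g i \<in> padic_ideal k) \<Longrightarrow> sum g A \<in> padic_ideal k"
  by (induction A rule: infinite_finite_induct) (auto intro: padic_ideal_add)

lemma rpoly_in_ideal_iff:
  assumes "\<omega> \<in> space M" "s \<le> m"
  shows "poly (rpoly \<omega>) (of_int a) \<in> padic_ideal s \<longleftrightarrow> int CARD('p) ^ s dvd residue_value (coeff_residues m \<omega>) a"
proof -
  have "poly (rpoly \<omega>) (of_int a) - of_int (residue_value (coeff_residues m \<omega>) a) =
      (\<Sum>i<n. of_int (a ^ i) * (\<xi> i \<omega> - of_int (padic_residue m (\<xi> i \<omega>))))"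
    by (simp add: rpoly_def residue_value_def coeff_residues_def poly_sum poly_monom algebra_simps
        sum_subtractf)
  moreover have "\<dots> \<in> padic_ideal s"
    using padic_residue(3)[OF coeff_integral[OF _ assms(1)], of _ m] padic_ideal_mono[OF _ assms(2)]
    by (intro padic_ideal_sum padic_ideal_mult_integer of_int_in_padic_integers) auto
  ultimately have "poly (rpoly \<omega>) (of_int a) \<in> padic_ideal s \<longleftrightarrow>
      of_int (residue_value (coeff_residues m \<omega>) a) \<in> (padic_ideal s :: 'p padic set)"
    using padic_ideal_cong by metis
  thus ?thesis by (simp only: of_int_in_padic_ideal_iff)
qed

lemma pderiv_rpoly_in_ideal_iff:
  assumes "\<omega> \<in> space M" "s \<le> m"
  shows "poly (pderiv (rpoly \<omega>)) (of_int a) \<in> padic_ideal s \<longleftrightarrow>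
    int CARD('p) ^ s dvd residue_deriv (coeff_residues m \<omega>) a"
proof -
  have "poly (pderiv (rpoly \<omega>)) (of_int a) - of_int (residue_deriv (coeff_residues m \<omega>) a) =
      (\<Sum>i<n. of_int (int i * a ^ (i - 1)) * (\<xi> i \<omega> - of_int (padic_residue m (\<xi> i \<omega>))))"
    by (simp add: rpoly_def residue_deriv_def coeff_residues_def poly_sum poly_monom algebra_simps
        sum_subtractf pderiv_add pderiv_sum pderiv_monom)
  moreover have "\<dots> \<in> padic_ideal s"
    using padic_residue(3)[OF coeff_integral[OF _ assms(1)], of _ m] padic_ideal_mono[OF _ assms(2)]
    by (intro padic_ideal_sum padic_ideal_mult_integer of_int_in_padic_integers) auto
  ultimately have "poly (pderiv (rpoly \<omega>)) (of_int a) \<in> padic_ideal s \<longleftrightarrow>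
      of_int (residue_deriv (coeff_residues m \<omega>) a) \<in> (padic_ideal s :: 'p padic set)"
    using padic_ideal_cong by metis
  thus ?thesis by (simp only: of_int_in_padic_ideal_iff)
qed

lemma indep_residues: "indep_vars (\<lambda>_. count_space UNIV) (\<lambda>i \<omega>. padic_residue m (\<xi> i \<omega>)) {..<n}"
  by (rule indep_vars_compose2[OF indep measurable_padic_residue])

lemma residues_event: "{\<omega> \<in> space M. P (coeff_residues m \<omega>)} \<in> events"
proof -
  have "coeff_residues m \<in> measurable M (PiM {..<n} (\<lambda>_. count_space UNIV))"
    unfolding coeff_residues_def
    by (rule measurable_restrict) (use indep_residues[of m] in \<open>auto simp: indep_vars_def\<close>)
  hence "coeff_residues m \<in> measurable M (count_space (PiE {..<n} (\<lambda>_. UNIV)))"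
    by (simp add: count_space_PiM_finite)
  from measurable_sets[OF this, of "{r \<in> PiE {..<n} (\<lambda>_. UNIV). P r}"]
  have "coeff_residues m -` {r \<in> PiE {..<n} (\<lambda>_. UNIV). P r} \<inter> space M \<in> events" by simp
  moreover have "coeff_residues m -` {r \<in> PiE {..<n} (\<lambda>_. UNIV). P r} \<inter> space M = {\<omega> \<in> space M. P (coeff_residues m \<omega>)}"
    by (auto simp: coeff_residues_def)
  ultimately show ?thesis by simp
qed

lemma prob_residue_dvd:
  assumes "i < n" "s \<le> m"
  shows "prob {\<omega> \<in> space M. int CARD('p) ^ s dvd padic_residue m (\<xi> i \<omega>) + c} = 1 / real CARD('p) ^ s"
proof -
  have "int CARD('p) ^ s dvd padic_residue m (\<xi> i \<omega>) + c \<longleftrightarrow> \<xi> i \<omega> - of_int (- c) \<in> padic_ideal s"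
    if "\<omega> \<in> space M" for \<omega>
  proof -
    have "(\<xi> i \<omega> - of_int (- c)) - of_int (padic_residue m (\<xi> i \<omega>) + c) \<in> padic_ideal s"
      using padic_ideal_mono[OF padic_residue(3)[OF coeff_integral[OF assms(1) that]] assms(2)] by simp
    from padic_ideal_cong[OF this] show ?thesis by (simp only: of_int_in_padic_ideal_iff)
  qed
  hence "{\<omega> \<in> space M. int CARD('p) ^ s dvd padic_residue m (\<xi> i \<omega>) + c} =
      {\<omega> \<in> space M. \<xi> i \<omega> - of_int (- c) \<in> padic_ideal s}" by blast
  thus ?thesis by (simp only: prob_coset[OF assms(1)])
qed

text \<open>
  The value is the constant coefficient plus a function of the other coefficients, and the
  derivative is the linear coefficient plus a function of the later ones. Hence the pair of both has
  the law of two independent Haar distributed p-adic integers.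
\<close>

lemma prob_value_deriv:
  "prob {\<omega> \<in> space M. poly (rpoly \<omega>) (of_int a) \<in> padic_ideal s \<and>
      poly (pderiv (rpoly \<omega>)) (of_int a) \<in> padic_ideal t} = 1 / real CARD('p) ^ s * (1 / real CARD('p) ^ t)"
proof -
  (* A single modulus that determines both divisibility conditions. *)
  define m where "m = max s t"
  have st: "s \<le> m" "t \<le> m" by (auto simp: m_def)
  let ?R = "\<lambda>i \<omega>. padic_residue m (\<xi> i \<omega>)"
  define h :: "(nat \<Rightarrow> int) \<Rightarrow> int" where "h r = (\<Sum>i\<in>{1..<n}. r i * a ^ i) + a ^ n" for r
  define d where "d r = (\<Sum>i\<in>{1..<n}. int i * r i * a ^ (i - 1)) + int n * a ^ (n - 1)" for r
  define g where "g r = (\<Sum>i\<in>{2..<n}. int i * r i * a ^ (i - 1)) + int n * a ^ (n - 1)" for r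
  have pos: "int CARD('p) ^ k > 0" for k using CARD_gt_1[where 'p = 'p] by simp
  have val: "residue_value (coeff_residues m \<omega>) a = ?R 0 \<omega> + h (\<lambda>i\<in>{1..<n}. ?R i \<omega>)" for \<omega>
    using two_le_n
    by (simp add: residue_value_def h_def coeff_residues_def lessThan_atLeast0 sum.atLeast_Suc_lessThan)
  have deriv: "residue_deriv (coeff_residues m \<omega>) a = d (\<lambda>i\<in>{1..<n}. ?R i \<omega>)" for \<omega>
    using two_le_n
    by (simp add: residue_deriv_def d_def coeff_residues_def lessThan_atLeast0 sum.atLeast_Suc_lessThan)
  have dg: "d (\<lambda>i\<in>{1..<n}. ?R i \<omega>) = ?R 1 \<omega> + g (\<lambda>i\<in>{2..<n}. ?R i \<omega>)" for \<omega>
    using two_le_n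
    by (simp add: d_def g_def sum.atLeast_Suc_lessThan numeral_2_eq_2)
  let ?A = "{\<omega> \<in> space M. int CARD('p) ^ s dvd ?R 0 \<omega> + h (\<lambda>i\<in>{1..<n}. ?R i \<omega>) \<and>
      int CARD('p) ^ t dvd d (\<lambda>i\<in>{1..<n}. ?R i \<omega>)}"
  let ?B = "{\<omega> \<in> space M. int CARD('p) ^ t dvd ?R 1 \<omega> + g (\<lambda>i\<in>{2..<n}. ?R i \<omega>) \<and> True}"
  have "{\<omega> \<in> space M. poly (rpoly \<omega>) (of_int a) \<in> padic_ideal s \<and>
      poly (pderiv (rpoly \<omega>)) (of_int a) \<in> padic_ideal t} = ?A"
    using rpoly_in_ideal_iff[OF _ st(1), of _ a] pderiv_rpoly_in_ideal_iff[OF _ st(2), of _ a]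
    unfolding val deriv by blast
  moreover have "prob ?A = 1 / real CARD('p) ^ s *
      prob {\<omega> \<in> space M. int CARD('p) ^ t dvd d (\<lambda>i\<in>{1..<n}. ?R i \<omega>)}"
  proof (rule prob_dvd_add_indep_vars[OF indep_residues])
    show "prob {\<omega> \<in> space M. int CARD('p) ^ s dvd ?R 0 \<omega> + c} = 1 / real CARD('p) ^ s" for c
      using two_le_n st by (intro prob_residue_dvd) auto
  qed (use two_le_n pos in auto)
  moreover have "{\<omega> \<in> space M. int CARD('p) ^ t dvd d (\<lambda>i\<in>{1..<n}. ?R i \<omega>)} = ?B"
    unfolding dg by blast
  moreover have "prob ?B = 1 / real CARD('p) ^ t * prob {\<omega> \<in> space M. True}"
  proof (rule prob_dvd_add_indep_vars[OF indep_residues])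
    show "prob {\<omega> \<in> space M. int CARD('p) ^ t dvd ?R 1 \<omega> + c} = 1 / real CARD('p) ^ t" for c
      using two_le_n st by (intro prob_residue_dvd) auto
  qed (use two_le_n pos in auto)
  ultimately show ?thesis by (simp only:) (simp add: prob_space)
qed

lemma value_event: "{\<omega> \<in> space M. poly (rpoly \<omega>) (of_int a) \<in> padic_ideal s} \<in> events"
proof -
  have "{\<omega> \<in> space M. poly (rpoly \<omega>) (of_int a) \<in> padic_ideal s} =
      {\<omega> \<in> space M. int CARD('p) ^ s dvd residue_value (coeff_residues s \<omega>) a}"
    using rpoly_in_ideal_iff[OF _ order_refl] by blast
  thus ?thesis using residues_event[of "\<lambda>r. int CARD('p) ^ s dvd residue_value r a" s] by simp
qed

lemma deriv_event: "{\<omega> \<in> space M. poly (pderiv (rpoly \<omega>)) (of_int a) \<in> padic_ideal s} \<in> events"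
proof -
  have "{\<omega> \<in> space M. poly (pderiv (rpoly \<omega>)) (of_int a) \<in> padic_ideal s} =
      {\<omega> \<in> space M. int CARD('p) ^ s dvd residue_deriv (coeff_residues s \<omega>) a}"
    using pderiv_rpoly_in_ideal_iff[OF _ order_refl] by blast
  thus ?thesis using residues_event[of "\<lambda>r. int CARD('p) ^ s dvd residue_deriv r a" s] by simp
qed

lemma root_event: "{\<omega> \<in> space M. has_root_in_coset (rpoly \<omega>) (of_int a) k} \<in> events"
proof -
  have "{\<omega> \<in> space M. has_root_in_coset (rpoly \<omega>) (of_int a) k} =
      {\<omega> \<in> space M. \<forall>m. \<exists>b. of_int b - of_int a \<in> (padic_ideal k :: 'p padic set) \<and>
        poly (rpoly \<omega>) (of_int b) \<in> padic_ideal m}"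
    using has_root_in_coset_iff_approx[OF integral_rpoly of_int_in_padic_integers] by blast
  also have "\<dots> \<in> events"
    by (intro sets.sets_Collect_countable_All sets.sets_Collect_countable_Ex sets.sets_Collect_conj
        value_event sets.sets_Collect_const)
  finally show ?thesis .
qed



section \<open>The expected number of roots\<close>

text \<open>
  Unless the derivative at the centre lies in the ideal of index k, Hensel's lemma decides by the
  valuations of value and derivative whether there is a root; the exceptional event has a
  probability of smaller order than the number of cosets can compensate.
\<close>

lemma prob_root_in_coset:
  fixes k :: nat and a :: int
  defines "q \<equiv> 1 / real CARD('p)"
  defines "m \<equiv> q ^ k * ((1 - q) * (\<Sum>j<k. (q ^ 2) ^ j))"
  shows "m \<le> prob {\<omega> \<in> space M. has_root_in_coset (rpoly \<omega>) (of_int a) k}"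
    and "prob {\<omega> \<in> space M. has_root_in_coset (rpoly \<omega>) (of_int a) k} \<le> m + q ^ k * (q ^ 2) ^ k"
proof -
  let ?Root = "{\<omega> \<in> space M. has_root_in_coset (rpoly \<omega>) (of_int a) k}"
  define V where "V s t = {\<omega> \<in> space M. poly (rpoly \<omega>) (of_int a) \<in> padic_ideal s \<and>
      poly (pderiv (rpoly \<omega>)) (of_int a) \<in> padic_ideal t}" for s t
  define W where "W j = V (k + j) j - V (k + j) (Suc j)" for j
  have V: "V s t \<in> events" for s t
    unfolding V_def by (intro sets.sets_Collect_conj value_event deriv_event)
  have pV: "prob (V s t) = q ^ s * q ^ t" for s t
    unfolding V_def q_def power_one_over prob_value_deriv ..
  have Vmono: "V s t' \<subseteq> V s t" if "t \<le> t'" for s t t'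
    using padic_ideal_mono[OF _ that] by (auto simp: V_def)
  have W: "W j \<in> events" for j using V by (simp add: W_def)
  have pW: "prob (W j) = q ^ k * ((1 - q) * (q ^ 2) ^ j)" for j
  proof -
    have "prob (W j) = prob (V (k + j) j) - prob (V (k + j) (Suc j))"
      unfolding W_def by (intro finite_measure_Diff V Vmono) simp
    also have "\<dots> = q ^ k * ((1 - q) * (q ^ 2) ^ j)"
      unfolding pV by (simp add: power_add power2_eq_square power_mult_distrib algebra_simps)
    finally show ?thesis .
  qed
  have disj: "disjoint_family_on W {..<k}"
  proof (unfold disjoint_family_on_def, intro ballI impI)
    have *: "W i \<inter> W j = {}" if "i < j" for i j
      using padic_ideal_mono[of _ j "Suc i"] that by (auto simp: W_def V_def)
    fix i j :: nat assume "i \<noteq> j"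
    thus "W i \<inter> W j = {}" using *[of i j] *[of j i] by (cases "i < j") auto
  qed
  have "prob (\<Union>j<k. W j) = (\<Sum>j<k. prob (W j))"
    by (rule finite_measure_finite_Union) (use W disj in auto)
  hence pU: "prob (\<Union>j<k. W j) = m" by (simp add: pW m_def sum_distrib_left)
  have Root: "?Root \<in> events" by (rule root_event)
  have U: "(\<Union>j<k. W j) \<in> events" using W by auto
  have "(\<Union>j<k. W j) \<subseteq> ?Root"
  proof
    fix \<omega> assume "\<omega> \<in> (\<Union>j<k. W j)"
    then obtain j where "j < k" "\<omega> \<in> W j" by blast
    thus "\<omega> \<in> ?Root"
      using hensel_coset[OF integral_rpoly of_int_in_padic_integers, of \<omega> j k a]
      by (auto simp: W_def V_def)
  qed
  thus "m \<le> prob ?Root" unfolding pU[symmetric] by (rule finite_measure_mono[OF _ Root])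
  have "?Root \<subseteq> (\<Union>j<k. W j) \<union> V (k + k) k"
  proof
    fix \<omega> assume "\<omega> \<in> ?Root"
    hence \<omega>: "\<omega> \<in> space M" and root: "has_root_in_coset (rpoly \<omega>) (of_int a) k" by auto
    let ?d = "poly (pderiv (rpoly \<omega>)) (of_int a)"
    note val = value_at_centre_of_root_coset[OF integral_rpoly[OF \<omega>] of_int_in_padic_integers _ _ root]
    show "\<omega> \<in> (\<Union>j<k. W j) \<union> V (k + k) k"
    proof (cases "?d \<in> padic_ideal k")
      case True
      thus ?thesis using val[of k] \<omega> by (simp add: V_def)
    next
      case False
      have "?d \<in> padic_ideal 0"
        using \<omega> by (simp add: padic_ideal_0 poly_in_padic_integers integral_poly_pderiv integral_rpoly)
      then obtain j where j: "j < k" "?d \<in> padic_ideal j" "?d \<notin> padic_ideal (Suc j)"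
        using ex_least_nat_less[of "\<lambda>i. ?d \<notin> padic_ideal i" k] False by auto
      hence "\<omega> \<in> W j" using val[of j] \<omega> by (simp add: W_def V_def)
      thus ?thesis using j(1) by blast
    qed
  qed
  hence "prob ?Root \<le> prob ((\<Union>j<k. W j) \<union> V (k + k) k)"
    by (rule finite_measure_mono) (use U V in auto)
  also have "\<dots> \<le> prob (\<Union>j<k. W j) + prob (V (k + k) k)"
    by (rule measure_Un_le[OF U V])
  also have "prob (V (k + k) k) = q ^ k * (q ^ 2) ^ k"
    unfolding pV by (simp add: power_add power2_eq_square power_mult_distrib)
  finally show "prob ?Root \<le> m + q ^ k * (q ^ 2) ^ k" by (simp only: pU)
qed

lemma card_root_cosets_eq_sum:
  assumes "\<omega> \<in> space M"
  shows "real (card (root_cosets (rpoly \<omega>) k)) = (\<Sum>a\<in>{0..<int CARD('p) ^ k}.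
    indicator {\<omega> \<in> space M. has_root_in_coset (rpoly \<omega>) (of_int a) k} \<omega>)"
proof -
  have "(\<Sum>a\<in>{0..<int CARD('p) ^ k}. indicator {\<omega> \<in> space M. has_root_in_coset (rpoly \<omega>) (of_int a) k} \<omega>)
      = (\<Sum>a\<in>{0..<int CARD('p) ^ k}. if has_root_in_coset (rpoly \<omega>) (of_int a) k then 1 else (0 :: real))"
    using assms by (intro sum.cong) (auto simp: indicator_def)
  also have "\<dots> = (\<Sum>a\<in>root_cosets (rpoly \<omega>) k. 1)"
    unfolding root_cosets_def by (rule sum.inter_filter[symmetric]) simp
  finally show ?thesis by simp
qed

lemma measurable_card_root_cosets:
  "(\<lambda>\<omega>. real (card (root_cosets (rpoly \<omega>) k))) \<in> borel_measurable M"
proof -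
  have "(\<lambda>\<omega>. \<Sum>a\<in>{0..<int CARD('p) ^ k}.
      indicator {\<omega> \<in> space M. has_root_in_coset (rpoly \<omega>) (of_int a) k} \<omega> :: real) \<in> borel_measurable M"
    by (intro borel_measurable_sum borel_measurable_indicator root_event)
  thus ?thesis by (subst measurable_cong[OF card_root_cosets_eq_sum])
qed

lemma expectation_card_root_cosets:
  "expectation (\<lambda>\<omega>. real (card (root_cosets (rpoly \<omega>) k))) =
    (\<Sum>a\<in>{0..<int CARD('p) ^ k}. prob {\<omega> \<in> space M. has_root_in_coset (rpoly \<omega>) (of_int a) k})"
proof -
  let ?Root = "\<lambda>a. {\<omega> \<in> space M. has_root_in_coset (rpoly \<omega>) (of_int a) k}"
  have "expectation (\<lambda>\<omega>. real (card (root_cosets (rpoly \<omega>) k))) =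
      expectation (\<lambda>\<omega>. \<Sum>a\<in>{0..<int CARD('p) ^ k}. indicator (?Root a) \<omega>)"
    by (intro Bochner_Integration.integral_cong refl card_root_cosets_eq_sum)
  also have "\<dots> = (\<Sum>a\<in>{0..<int CARD('p) ^ k}. expectation (indicator (?Root a)))"
    by (intro Bochner_Integration.integral_sum integrable_real_indicator root_event)
      (simp add: emeasure_eq_measure)
  also have "\<dots> = (\<Sum>a\<in>{0..<int CARD('p) ^ k}. prob (?Root a))"
    by (intro sum.cong refl) (simp add: Int_def conj_commute conj_left_commute)
  finally show ?thesis .
qed

lemma expectation_card_root_cosets_tendsto:
  "(\<lambda>k. expectation (\<lambda>\<omega>. real (card (root_cosets (rpoly \<omega>) k))))
    \<longlonglongrightarrow> real CARD('p) / (real CARD('p) + 1)"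
proof -
  define q where "q = 1 / real CARD('p)"
  have p1: "real CARD('p) > 1" by (rule CARD_gt_1)
  have q: "0 < q" "q < 1" using p1 by (simp_all add: q_def)
  have q2: "norm (q ^ 2) < 1" using q by (simp add: power_less_one_iff abs_square_less_1)
  let ?E = "\<lambda>k. expectation (\<lambda>\<omega>. real (card (root_cosets (rpoly \<omega>) k)))"
  let ?G = "\<lambda>k. (1 - q) * (\<Sum>j<k. (q ^ 2) ^ j)"
  have card: "real (card {0..<int CARD('p) ^ k}) * q ^ k = 1" for k
    using p1 by (simp add: q_def nat_power_eq power_one_over)
  have lower: "?G k \<le> ?E k" for k
  proof -
    have "?G k = (real (card {0..<int CARD('p) ^ k}) * q ^ k) * ?G k" by (simp only: card mult_1)
    also have "\<dots> = (\<Sum>a\<in>{0..<int CARD('p) ^ k}. q ^ k * ?G k)" by (simp only: sum_constant mult.assoc)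
    also have "\<dots> \<le> ?E k"
      unfolding expectation_card_root_cosets using prob_root_in_coset(1)
      by (intro sum_mono) (simp add: q_def)
    finally show ?thesis .
  qed
  have upper: "?E k \<le> ?G k + (q ^ 2) ^ k" for k
  proof -
    have "?E k \<le> (\<Sum>a\<in>{0..<int CARD('p) ^ k}. q ^ k * (?G k + (q ^ 2) ^ k))"
      unfolding expectation_card_root_cosets distrib_left using prob_root_in_coset(2)
      by (intro sum_mono) (simp add: q_def)
    also have "\<dots> = (real (card {0..<int CARD('p) ^ k}) * q ^ k) * (?G k + (q ^ 2) ^ k)"
      by (simp only: sum_constant mult.assoc)
    also have "\<dots> = ?G k + (q ^ 2) ^ k" by (simp only: card mult_1)
    finally show ?thesis .
  qed
  have "(\<lambda>k. \<Sum>j<k. (q ^ 2) ^ j) \<longlonglongrightarrow> 1 / (1 - q ^ 2)"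
    using geometric_sums[OF q2] by (simp add: sums_def)
  hence "?G \<longlonglongrightarrow> (1 - q) * (1 / (1 - q ^ 2))" by (rule tendsto_mult_left)
  moreover have "1 - q ^ 2 = (1 - q) * (1 + q)" by (simp add: power2_eq_square algebra_simps)
  hence "(1 - q) * (1 / (1 - q ^ 2)) = 1 / (1 + q)" using q by simp
  moreover have "1 / (1 + q) = real CARD('p) / (real CARD('p) + 1)"
    using p1 by (simp add: q_def field_simps)
  ultimately have G: "?G \<longlonglongrightarrow> real CARD('p) / (real CARD('p) + 1)" by simp
  have "(\<lambda>k. (q ^ 2) ^ k) \<longlonglongrightarrow> 0" using q2 by (rule LIMSEQ_power_zero)
  from tendsto_add[OF G this]
  have G': "(\<lambda>k. ?G k + (q ^ 2) ^ k) \<longlonglongrightarrow> real CARD('p) / (real CARD('p) + 1)" by simp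
  show ?thesis
    by (rule tendsto_sandwich[OF always_eventually always_eventually G G']) (use lower upper in auto)
qed

lemma expectation_root_count:
  "expectation (\<lambda>\<omega>. real (root_count (rpoly \<omega>))) = real CARD('p) / (real CARD('p) + 1)"
proof -
  have lim: "(\<lambda>k. real (card (root_cosets (rpoly \<omega>) k))) \<longlonglongrightarrow> real (root_count (rpoly \<omega>))"
    if "\<omega> \<in> space M" for \<omega>
    using eventually_card_root_cosets[OF integral_rpoly[OF that] monic_rpoly]
    by (intro tendsto_eventually) (auto elim: eventually_mono)
  have "(\<lambda>k. expectation (\<lambda>\<omega>. real (card (root_cosets (rpoly \<omega>) k))))
      \<longlonglongrightarrow> expectation (\<lambda>\<omega>. real (root_count (rpoly \<omega>)))"
  proof (rule integral_dominated_convergence[where w = "\<lambda>_. real n"])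
    show "(\<lambda>\<omega>. real (root_count (rpoly \<omega>))) \<in> borel_measurable M"
      by (rule borel_measurable_LIMSEQ_real[OF lim measurable_card_root_cosets])
    show "AE \<omega> in M. norm (real (card (root_cosets (rpoly \<omega>) k))) \<le> real n" for k
      using card_root_cosets_le[OF integral_rpoly monic_rpoly] by (intro AE_I2) (simp add: degree_rpoly)
  qed (use lim measurable_card_root_cosets in auto)
  thus ?thesis using expectation_card_root_cosets_tendsto LIMSEQ_unique by blast
qed

end

lemma haar_random_polyI:
  fixes \<mu> :: "'p::prime_card padic measure" and \<xi> :: "nat \<Rightarrow> 'a \<Rightarrow> 'p padic"
  assumes "n \<ge> 2" "prob_space M" "padic_haar_measure \<mu>"
    and indep: "prob_space.indep_vars M (\<lambda>_. restrict_space borel padic_integers) \<xi> {..<n}"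
    and law: "\<And>i. i < n \<Longrightarrow>
      distr M (restrict_space borel padic_integers) (\<xi> i) = restrict_space \<mu> padic_integers"
  shows "haar_random_poly M \<xi> n"
proof -
  interpret prob_space M by fact
  let ?Z = "padic_integers :: 'p padic set"
  have sets: "sets \<mu> = sets borel"
    using assms(3) by (simp add: padic_haar_measure_def regular_borel_measure_def)
  show ?thesis
  proof
    fix i m and a :: int assume i: "i < n"
    let ?C = "{x :: 'p padic. x - of_int a \<in> padic_ideal m}"
    have sub: "?C \<subseteq> ?Z" using padic_coset_subset_integers[OF of_int_in_padic_integers] by blast
    have meas: "\<xi> i \<in> measurable M (restrict_space borel ?Z)"
      using indep i by (auto simp: indep_vars_def)
    have C: "?C \<in> sets (restrict_space borel ?Z)"
      using sub by (simp add: sets_restrict_space_iff)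
    have "{\<omega> \<in> space M. \<xi> i \<omega> - of_int a \<in> padic_ideal m} = \<xi> i -` ?C \<inter> space M" by auto
    hence "emeasure M {\<omega> \<in> space M. \<xi> i \<omega> - of_int a \<in> padic_ideal m} =
        emeasure (distr M (restrict_space borel ?Z) (\<xi> i)) ?C"
      using emeasure_distr[OF meas C] by simp
    also have "\<dots> = emeasure \<mu> ?C"
      unfolding law[OF i] by (rule emeasure_restrict_space) (use sub sets in auto)
    also have "\<dots> = ennreal (1 / real CARD('p) ^ m)" by (rule emeasure_padic_coset[OF assms(3)])
    finally show "prob {\<omega> \<in> space M. \<xi> i \<omega> - of_int a \<in> padic_ideal m} = 1 / real CARD('p) ^ m"
      by (simp add: measure_def)
  qed (use assms(1) indep in auto)
qed

theorem mainTheorem4: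
  fixes M :: "'a measure"
    and \<mu> :: "'p::prime_card padic measure"
    and \<xi> :: "nat \<Rightarrow> 'a \<Rightarrow> 'p padic"
    and n :: nat
  assumes "n \<ge> 2"
    and "prob_space M"
    and "padic_haar_measure \<mu>"
    and "prob_space.indep_vars M (\<lambda>_. restrict_space borel padic_integers) \<xi> {..<n}"
    and "\<And>i. i < n \<Longrightarrow>
      distr M (restrict_space borel padic_integers) (\<xi> i) = restrict_space \<mu> padic_integers"
  shows "prob_space.expectation M
      (\<lambda>\<omega>. real (root_count ((\<Sum>i<n. Polynomial.monom (\<xi> i \<omega>) i) + Polynomial.monom 1 n)))
    = real CARD('p) / (real CARD('p) + 1)"
proof -
  interpret haar_random_poly M \<xi> n by (rule haar_random_polyI) fact+
  show ?thesis using expectation_root_count by (simp only: rpoly_def)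
qed

end
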